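(* Let $\Delta$ be a thick (non-degenerate) polar space of finite rank $n\ge 2$. Then $\Delta$ is Moufang if and only if it satisfies both of the following properties. (M1) For any point $c$ and any two distinct noncoplanar lines $L$ and $L'$ through $c$, and for all $x\in L\setminus\{c\}$ and $x'\in L'\setminus\{c\}$, the group of point elations with center $(L,c,L')$ acts transitively on the set of points opposite $c$ in $x^\perp\cap x'^\perp$. (M2) For any line $L$ and any two distinct points $p$ and $q$ on $L$, and for every line $K$ through $p$ that is not coplanar with $L$, the group of line elations with center $(p,L,q)$ acts transitively on $K\setminus\{p\}$.
   Context: A point-line geometry is a pair $(\mathcal P,\mathcal L)$ with $\mathcal P$ a set (points) and $\mathcal L$ a set of subsets of $\mathcal P$ (lines). Points $x,y$ on a common line are collinear, $x\perp y$ (each point is regarded as collinear to itself); $x^\perp$ is the set of points collinear to $x$ and $P^\perp=\bigcap_{x\in P}x^\perp$. A subspace is a set of points containing every line that meets it in at least two points; a hyperplane is a subspace meeting every line; it is proper if it is not the whole point set. A (non-degenerate) polar space is a point-line geometry in which every line has at least three points and $x^\perp$ is a proper hyperplane for every point $x$. A singular subspace is a subspace of pairwise collinear points; singular subspaces are empty, points, lines or projective spaces, and planes are the singular subspaces of projective dimension 2. Two distinct lines are coplanar if they lie in a common (singular) plane. Two points are opposite if they are not collinear. The rank $n$ is finite if maximal singular subspaces are generated by finitely many points, and is then the minimal number of generators (maximal singular subspaces have projective dimension $n-1$). A finite-rank polar space is thick if every submaximal singular subspace (hyperplane of a maximal one) is contained in at least three maximal singular subspaces. A collineation is a permutation of the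 points inducing a permutation of the lines. Point elations. For two distinct noncoplanar lines $L,L'$ through a point $c$, a point elation with center $(L,c,L')$ is a collineation stabilizing all singular subspaces containing $c$ and fixing $L$ and $L'$ pointwise. Line elations. For a line $L$ and distinct points $p,q\in L$, a line elation with center $(p,L,q)$ is a collineation fixing all points of $L$ and stabilizing all singular subspaces containing $p$ or $q$. Apartments and roots. A polar frame is a set of $2n$ points $p_{-n},\dots,p_{-1},p_1,\dots,p_n$ with $p_i\perp p_j$ if and only if $i+j\ne0$. The corresponding apartment $\mathcal A$ is the set of all singular subspaces spanned by points of the frame. A root of the first kind is obtained from $\mathcal A$ by choosing a frame point $p_i$ and removing all members of $\mathcal A$ containing $p_i$; its interior $\alpha^+$ consists of the members of $\mathcal A$ containing $p_{-i}$. A root of the second kind is obtained by choosing two distinct collinear frame points $p_i,p_j$ and removing every member of $\mathcal A$ that contains $p_i$ or $p_j$ and is contained in a maximal member of $\mathcal A$ containing both $p_i$ and $p_j$; its interior $\alpha^+$ consists of the members of $\mathcal A$ that contain at least one of $p_{-i},p_{-j}$ and neither $p_i$ nor $p_j$. Moufang property. $\Delta$ is Moufang if for every root $\alpha$ (of either kind) the group of collineations of $\Delta$ that fix every point of every member of $\alpha^+$ and stabilize every singular subspace incident with (containing or contained in) some member of $\alpha^+$ acts transitively on the set of apartments containing $\alpha$. *)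

theory Defs
  imports Main "HOL-Combinatorics.Permutations"
begin

text \<open>
  A point-line geometry is given by its point set \<open>P\<close> and its set \<open>L\<close> of lines, each line
  being a set of points.
\<close>

definition point_line_geometry :: "'a set \<Rightarrow> 'a set set \<Rightarrow> bool" where
  "point_line_geometry P L \<longleftrightarrow> (\<forall>l\<in>L. l \<subseteq> P)"

definition collinear_pts :: "'a set \<Rightarrow> 'a set set \<Rightarrow> 'a \<Rightarrow> 'a \<Rightarrow> bool" where
  "collinear_pts P L x y \<longleftrightarrow> x \<in> P \<and> y \<in> P \<and> (x = y \<or> (\<exists>l\<in>L. x \<in> l \<and> y \<in> l))"

definition opposite_pts :: "'a set \<Rightarrow> 'a set set \<Rightarrow> 'a \<Rightarrow> 'a \<Rightarrow> bool" where
  "opposite_pts P L x y \<longleftrightarrow> x \<in> P \<and> y \<in> P \<and> \<not> collinear_pts P L x y"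

definition perp :: "'a set \<Rightarrow> 'a set set \<Rightarrow> 'a \<Rightarrow> 'a set" where
  "perp P L x = {y. collinear_pts P L x y}"

definition geom_subspace :: "'a set \<Rightarrow> 'a set set \<Rightarrow> 'a set \<Rightarrow> bool" where
  "geom_subspace P L S \<longleftrightarrow>
     S \<subseteq> P \<and> (\<forall>l\<in>L. (\<exists>x\<in>l \<inter> S. \<exists>y\<in>l \<inter> S. x \<noteq> y) \<longrightarrow> l \<subseteq> S)"

definition geom_hyperplane :: "'a set \<Rightarrow> 'a set set \<Rightarrow> 'a set \<Rightarrow> bool" where
  "geom_hyperplane P L H \<longleftrightarrow> geom_subspace P L H \<and> (\<forall>l\<in>L. l \<inter> H \<noteq> {})"

definition proper_hyperplane :: "'a set \<Rightarrow> 'a set set \<Rightarrow> 'a set \<Rightarrow> bool" where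
  "proper_hyperplane P L H \<longleftrightarrow> geom_hyperplane P L H \<and> H \<noteq> P"

definition polar_space :: "'a set \<Rightarrow> 'a set set \<Rightarrow> bool" where
  "polar_space P L \<longleftrightarrow>
     point_line_geometry P L \<and>
     (\<forall>l\<in>L. \<exists>T\<subseteq>l. card T = 3) \<and>
     (\<forall>x\<in>P. proper_hyperplane P L (perp P L x))"

definition singular_subspace :: "'a set \<Rightarrow> 'a set set \<Rightarrow> 'a set \<Rightarrow> bool" where
  "singular_subspace P L S \<longleftrightarrow>
     geom_subspace P L S \<and> (\<forall>x\<in>S. \<forall>y\<in>S. collinear_pts P L x y)"

definition maximal_singular :: "'a set \<Rightarrow> 'a set set \<Rightarrow> 'a set \<Rightarrow> bool" where
  "maximal_singular P L M \<longleftrightarrow>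
     singular_subspace P L M \<and> (\<forall>S. singular_subspace P L S \<and> M \<subseteq> S \<longrightarrow> S = M)"

definition generated :: "'a set \<Rightarrow> 'a set set \<Rightarrow> 'a set \<Rightarrow> 'a set" where
  "generated P L X = \<Inter>{S. geom_subspace P L S \<and> X \<subseteq> S}"

definition min_generators :: "'a set \<Rightarrow> 'a set set \<Rightarrow> 'a set \<Rightarrow> nat \<Rightarrow> bool" where
  "min_generators P L S k \<longleftrightarrow>
     (\<exists>X\<subseteq>P. finite X \<and> card X = k \<and> generated P L X = S) \<and>
     (\<forall>X\<subseteq>P. finite X \<and> generated P L X = S \<longrightarrow> k \<le> card X)"

definition has_finite_rank :: "'a set \<Rightarrow> 'a set set \<Rightarrow> nat \<Rightarrow> bool" where
  "has_finite_rank P L n \<longleftrightarrow> (\<forall>M. maximal_singular P L M \<longrightarrow> min_generators P L M n)"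

text \<open>A projective space has projective dimension 2 iff its minimal number of generators is 3.\<close>

definition sing_plane :: "'a set \<Rightarrow> 'a set set \<Rightarrow> 'a set \<Rightarrow> bool" where
  "sing_plane P L S \<longleftrightarrow> singular_subspace P L S \<and> min_generators P L S 3"

text \<open>Coplanarity is only meaningful for distinct lines; distinctness is required at each use.\<close>

definition coplanar_lines :: "'a set \<Rightarrow> 'a set set \<Rightarrow> 'a set \<Rightarrow> 'a set \<Rightarrow> bool" where
  "coplanar_lines P L K K' \<longleftrightarrow> (\<exists>S. sing_plane P L S \<and> K \<subseteq> S \<and> K' \<subseteq> S)"

text \<open>
  A hyperplane of a singular subspace \<open>M\<close> is a proper hyperplane of the geometry induced on \<open>M\<close>.
\<close>

definition submaximal_singular :: "'a set \<Rightarrow> 'a set set \<Rightarrow> 'a set \<Rightarrow> bool" where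
  "submaximal_singular P L H \<longleftrightarrow>
     (\<exists>M. maximal_singular P L M \<and> proper_hyperplane M {l \<in> L. l \<subseteq> M} H)"

definition thick :: "'a set \<Rightarrow> 'a set set \<Rightarrow> bool" where
  "thick P L \<longleftrightarrow>
     (\<forall>H. submaximal_singular P L H \<longrightarrow>
        (\<exists>T\<subseteq>{M. maximal_singular P L M \<and> H \<subseteq> M}. card T = 3))"

definition collineation :: "'a set \<Rightarrow> 'a set set \<Rightarrow> ('a \<Rightarrow> 'a) \<Rightarrow> bool" where
  "collineation P L g \<longleftrightarrow> g permutes P \<and> bij_betw (image g) L L"

definition fixes_pointwise :: "('a \<Rightarrow> 'a) \<Rightarrow> 'a set \<Rightarrow> bool" where
  "fixes_pointwise g S \<longleftrightarrow> (\<forall>x\<in>S. g x = x)"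

definition stabilizes :: "('a \<Rightarrow> 'a) \<Rightarrow> 'a set \<Rightarrow> bool" where
  "stabilizes g S \<longleftrightarrow> g ` S = S"

text \<open>
  \<open>act g x\<close> is the image of \<open>x\<close> under \<open>g\<close>.  That \<open>G\<close> acts on \<open>X\<close> (first conjunct) is part of
  the notion.
\<close>

definition acts_transitively :: "('g \<Rightarrow> 'x \<Rightarrow> 'x) \<Rightarrow> 'g set \<Rightarrow> 'x set \<Rightarrow> bool" where
  "acts_transitively act G X \<longleftrightarrow>
     (\<forall>g\<in>G. \<forall>x\<in>X. act g x \<in> X) \<and> (\<forall>x\<in>X. \<forall>y\<in>X. \<exists>g\<in>G. act g x = y)"

definition point_elations ::
  "'a set \<Rightarrow> 'a set set \<Rightarrow> 'a set \<Rightarrow> 'a \<Rightarrow> 'a set \<Rightarrow> ('a \<Rightarrow> 'a) set" where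
  "point_elations P L K c K' =
     {g. collineation P L g \<and>
         (\<forall>S. singular_subspace P L S \<and> c \<in> S \<longrightarrow> stabilizes g S) \<and>
         fixes_pointwise g K \<and> fixes_pointwise g K'}"

definition line_elations ::
  "'a set \<Rightarrow> 'a set set \<Rightarrow> 'a \<Rightarrow> 'a set \<Rightarrow> 'a \<Rightarrow> ('a \<Rightarrow> 'a) set" where
  "line_elations P L p K q =
     {g. collineation P L g \<and>
         fixes_pointwise g K \<and>
         (\<forall>S. singular_subspace P L S \<and> (p \<in> S \<or> q \<in> S) \<longrightarrow> stabilizes g S)}"

definition frame_index :: "nat \<Rightarrow> int set" where
  "frame_index n = {i. i \<noteq> 0 \<and> \<bar>i\<bar> \<le> int n}"

definition polar_frame :: "'a set \<Rightarrow> 'a set set \<Rightarrow> nat \<Rightarrow> (int \<Rightarrow> 'a) \<Rightarrow> bool" where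
  "polar_frame P L n p \<longleftrightarrow>
     p ` frame_index n \<subseteq> P \<and> inj_on p (frame_index n) \<and>
     (\<forall>i\<in>frame_index n. \<forall>j\<in>frame_index n. collinear_pts P L (p i) (p j) \<longleftrightarrow> i + j \<noteq> 0)"

definition frame_apartment :: "'a set \<Rightarrow> 'a set set \<Rightarrow> nat \<Rightarrow> (int \<Rightarrow> 'a) \<Rightarrow> 'a set set" where
  "frame_apartment P L n p =
     {S. singular_subspace P L S \<and> (\<exists>X\<subseteq>p ` frame_index n. S = generated P L X)}"

definition apartments :: "'a set \<Rightarrow> 'a set set \<Rightarrow> nat \<Rightarrow> 'a set set set" where
  "apartments P L n = {frame_apartment P L n p |p. polar_frame P L n p}"

definition root1 :: "'a set \<Rightarrow> 'a set set \<Rightarrow> nat \<Rightarrow> (int \<Rightarrow> 'a) \<Rightarrow> int \<Rightarrow> 'a set set" where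
  "root1 P L n p i = {S \<in> frame_apartment P L n p. p i \<notin> S}"

definition root1_interior :: "'a set \<Rightarrow> 'a set set \<Rightarrow> nat \<Rightarrow> (int \<Rightarrow> 'a) \<Rightarrow> int \<Rightarrow> 'a set set" where
  "root1_interior P L n p i = {S \<in> frame_apartment P L n p. p (- i) \<in> S}"

definition maximal_member :: "'a set set \<Rightarrow> 'a set \<Rightarrow> bool" where
  "maximal_member A M \<longleftrightarrow> M \<in> A \<and> (\<forall>S\<in>A. M \<subseteq> S \<longrightarrow> S = M)"

definition root2 :: "'a set \<Rightarrow> 'a set set \<Rightarrow> nat \<Rightarrow> (int \<Rightarrow> 'a) \<Rightarrow> int \<Rightarrow> int \<Rightarrow> 'a set set" where
  "root2 P L n p i j =
     {S \<in> frame_apartment P L n p.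
        \<not> ((p i \<in> S \<or> p j \<in> S) \<and>
           (\<exists>M. maximal_member (frame_apartment P L n p) M \<and> p i \<in> M \<and> p j \<in> M \<and> S \<subseteq> M))}"

definition root2_interior ::
  "'a set \<Rightarrow> 'a set set \<Rightarrow> nat \<Rightarrow> (int \<Rightarrow> 'a) \<Rightarrow> int \<Rightarrow> int \<Rightarrow> 'a set set" where
  "root2_interior P L n p i j =
     {S \<in> frame_apartment P L n p. (p (- i) \<in> S \<or> p (- j) \<in> S) \<and> p i \<notin> S \<and> p j \<notin> S}"

text \<open>
  The pairs \<open>(\<alpha>, \<alpha>\<^sup>+)\<close> of a root and its interior, for both kinds of roots.
\<close>

definition roots_with_interior :: "'a set \<Rightarrow> 'a set set \<Rightarrow> nat \<Rightarrow> ('a set set \<times> 'a set set) set" where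
  "roots_with_interior P L n =
     {(root1 P L n p i, root1_interior P L n p i) |p i.
        polar_frame P L n p \<and> i \<in> frame_index n} \<union>
     {(root2 P L n p i j, root2_interior P L n p i j) |p i j.
        polar_frame P L n p \<and> i \<in> frame_index n \<and> j \<in> frame_index n \<and>
        p i \<noteq> p j \<and> collinear_pts P L (p i) (p j)}"

definition root_elations :: "'a set \<Rightarrow> 'a set set \<Rightarrow> 'a set set \<Rightarrow> ('a \<Rightarrow> 'a) set" where
  "root_elations P L B =
     {g. collineation P L g \<and>
         (\<forall>S\<in>B. fixes_pointwise g S) \<and>
         (\<forall>T. singular_subspace P L T \<and> (\<exists>S\<in>B. S \<subseteq> T \<or> T \<subseteq> S) \<longrightarrow> stabilizes g T)}"

text \<open>A collineation \<open>g\<close> maps an apartment \<open>A\<close> to \<open>{g ` S | S \<in> A}\<close>.\<close>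

definition moufang :: "'a set \<Rightarrow> 'a set set \<Rightarrow> nat \<Rightarrow> bool" where
  "moufang P L n \<longleftrightarrow>
     (\<forall>(\<alpha>, B) \<in> roots_with_interior P L n.
        acts_transitively (\<lambda>g A. (image g) ` A) (root_elations P L B)
          {A \<in> apartments P L n. \<alpha> \<subseteq> A})"

definition property_M1 :: "'a set \<Rightarrow> 'a set set \<Rightarrow> bool" where
  "property_M1 P L \<longleftrightarrow>
     (\<forall>c\<in>P. \<forall>K\<in>L. \<forall>K'\<in>L.
        c \<in> K \<and> c \<in> K' \<and> K \<noteq> K' \<and> \<not> coplanar_lines P L K K' \<longrightarrow>
        (\<forall>x \<in> K - {c}. \<forall>x' \<in> K' - {c}.
           acts_transitively (\<lambda>g y. g y) (point_elations P L K c K')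
             {y \<in> perp P L x \<inter> perp P L x'. opposite_pts P L c y}))"

definition property_M2 :: "'a set \<Rightarrow> 'a set set \<Rightarrow> bool" where
  "property_M2 P L \<longleftrightarrow>
     (\<forall>M\<in>L. \<forall>p\<in>M. \<forall>q\<in>M. p \<noteq> q \<longrightarrow>
        (\<forall>K\<in>L. p \<in> K \<and> K \<noteq> M \<and> \<not> coplanar_lines P L K M \<longrightarrow>
           acts_transitively (\<lambda>g y. g y) (line_elations P L p M q) (K - {p})))"

end

theory Submission imports Defs begin

text \<open>
  In a frame with interior points \<open>p = p\<^sub>-\<^sub>i\<close>, \<open>q = p\<^sub>-\<^sub>j\<close>, a line elation with centre
  \<open>(p, pq, q)\<close> fixes every point \<open>u \<in> {p, q}\<^sup>\<bottom>\<close> off \<open>pq\<close>, as \<open>u\<close> is the intersection of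
  \<open>pu\<close> and \<open>qu\<close>.  Hence it is a root elation of the second kind, and (M2) is the transitivity of
  these.  A point elation with centre \<open>(L, c, L')\<close> that fixes all frame points collinear with
  \<open>c\<close> fixes the singular subspaces of the apartment through \<open>c\<close> pointwise, so (M1) gives the
  roots of the first kind.

  Conversely, root elations of the second kind give (M2) at once, but for rank at least 3 those of
  the first kind move \<open>y\<close> only to points \<open>y'\<close> collinear with a whole frame of
  \<open>{c, y, x, x'}\<^sup>\<bottom>\<close>.  The remaining cases of (M1) are covered by moving \<open>y\<close> along at most
  two lines of \<open>{x, x'}\<^sup>\<bottom>\<close> with elations of the second kind.
\<close>

subsection \<open>Lines of a polar space\<close>

text \<open>The definition of a polar space supplies only three points per line, nondegeneracy, and
  that a point is collinear with one or all points of a line. That two points lie on a single line,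
  that singular subspaces behave like projective spaces, and that spans have a bounded size all have
  to be derived. The device throughout is to identify a point by the points collinear with it and to
  transport a failure of collinearity along lines until it contradicts one-or-all. The rank is given
  by minimal generating sets, so its link to frames goes through families dual under collinearity.
  Apartments are unindexed sets of subspaces, so the Moufang property yields an elation between two
  apartments without saying where a single frame point goes; its image is found by excluding all
  other frame points. To use the property at all, the few points given in (M1) or (M2) must first be
  completed to a full frame.\<close>

locale polar =
  fixes P :: "'a set" and L :: "'a set set"
  assumes polar: "polar_space P L"
begin

abbreviation col (infix "\<perp>" 50) where "x \<perp> y \<equiv> collinear_pts P L x y"
abbreviation gen where "gen X \<equiv> generated P L X"
abbreviation singular where "singular S \<equiv> singular_subspace P L S"

lemma line_sub: "l \<in> L \<Longrightarrow> x \<in> l \<Longrightarrow> x \<in> P"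
  using polar unfolding polar_space_def point_line_geometry_def by blast

lemma col_in: "x \<perp> y \<Longrightarrow> x \<in> P" "x \<perp> y \<Longrightarrow> y \<in> P"
  unfolding collinear_pts_def by auto

lemma col_sym: "x \<perp> y \<longleftrightarrow> y \<perp> x"
  unfolding collinear_pts_def by auto

lemma col_refl: "x \<in> P \<Longrightarrow> x \<perp> x"
  unfolding collinear_pts_def by auto

lemma col_line: "l \<in> L \<Longrightarrow> x \<in> l \<Longrightarrow> y \<in> l \<Longrightarrow> x \<perp> y"
  using line_sub unfolding collinear_pts_def by auto

lemma col_obtain_line:
  assumes "x \<perp> y" "x \<noteq> y" obtains l where "l \<in> L" "x \<in> l" "y \<in> l"
  using assms unfolding collinear_pts_def by auto

lemma perp_subspace: "x \<in> P \<Longrightarrow> geom_subspace P L (perp P L x)"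
  using polar unfolding polar_space_def proper_hyperplane_def geom_hyperplane_def by blast

lemma col_line_all:
  assumes "l \<in> L" "a \<in> l" "b \<in> l" "a \<noteq> b" "x \<perp> a" "x \<perp> b" "c \<in> l"
  shows "x \<perp> c"
proof -
  have "geom_subspace P L (perp P L x)" using perp_subspace col_in assms by blast
  moreover have "a \<in> l \<inter> perp P L x" "b \<in> l \<inter> perp P L x" using assms by (auto simp: perp_def)
  ultimately have "l \<subseteq> perp P L x" using assms unfolding geom_subspace_def by blast
  then show ?thesis using assms by (auto simp: perp_def)
qed

lemma col_line_ex:
  assumes "l \<in> L" "x \<in> P" obtains a where "a \<in> l" "x \<perp> a"
proof -
  have "l \<inter> perp P L x \<noteq> {}"
    using assms polar unfolding polar_space_def proper_hyperplane_def geom_hyperplane_def by blast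
  then show ?thesis using that by (auto simp: perp_def)
qed

lemma nondegenerate:
  assumes "x \<in> P" obtains y where "y \<in> P" "\<not> y \<perp> x"
proof -
  have "perp P L x \<noteq> P" using assms polar unfolding polar_space_def proper_hyperplane_def by blast
  moreover have "perp P L x \<subseteq> P" using col_in by (auto simp: perp_def)
  ultimately show ?thesis using that col_sym by (auto simp: perp_def)
qed

lemma third_point:
  assumes "l \<in> L" obtains z where "z \<in> l" "z \<noteq> x" "z \<noteq> y"
proof -
  obtain T where T: "T \<subseteq> l" "card T = 3" using assms polar unfolding polar_space_def by blast
  have "\<not> T \<subseteq> {x, y}"
  proof
    assume "T \<subseteq> {x, y}"
    then have "card T \<le> card {x, y}" by (intro card_mono) auto
    also have "\<dots> \<le> 2" by (simp add: card_insert_if)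
    finally show False using T by simp
  qed
  then show ?thesis using that T by blast
qed

text \<open>If \<open>x\<close> and \<open>y\<close> were distinct, a point \<open>u\<close>
  opposite \<open>y\<close> and its neighbour \<open>v\<close> on the line \<open>xy\<close> would
  have the property \<open>key\<close>: everything collinear with \<open>u\<close> is collinear with
  \<open>v\<close>. Replacing \<open>u\<close> by the point of the line \<open>uv\<close> collinear
  with some \<open>s\<close> opposite \<open>v\<close> contradicts this.\<close>

lemma perp_sub_eq:
  assumes "x \<in> P" and sub: "\<And>z. z \<perp> x \<Longrightarrow> z \<perp> y"
  shows "x = y"
proof (rule ccontr)
  assume ne: "x \<noteq> y"
  have "x \<perp> y" using assms col_refl by blast
  then obtain l where l: "l \<in> L" "x \<in> l" "y \<in> l" using ne col_obtain_line by blast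
  \<comment> \<open>The point of the line \<open>su\<close> collinear with \<open>x\<close> is also
    collinear with \<open>y\<close>, hence with \<open>v\<close>, and it differs from
    \<open>u\<close>; so \<open>v\<close> is collinear with two points of that line.\<close>
  have key: "s \<perp> v" if h: "\<not> u \<perp> y" "v \<in> l" "u \<perp> v" "s \<perp> u" for u v s
  proof (cases "s = u")
    case False
    then obtain m where m: "m \<in> L" "s \<in> m" "u \<in> m" using h col_obtain_line by blast
    obtain w where w: "w \<in> m" "x \<perp> w" using col_line_ex m assms by blast
    have "w \<noteq> u" using w sub col_sym h by blast
    moreover have "v \<perp> w"
      using col_line_all[OF l ne] h w sub col_sym by blast
    ultimately show ?thesis using col_line_all[OF m(1) w(1) m(3)] m h col_sym by blast
  qed (use h in simp)
  obtain u where u: "u \<in> P" "\<not> u \<perp> y" using nondegenerate \<open>x \<perp> y\<close> col_in by blast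
  obtain v where v: "v \<in> l" "u \<perp> v" using col_line_ex l u by blast
  have vy: "y \<perp> v" using col_line l v by blast
  have "u \<noteq> v" using u v vy col_sym by blast
  then obtain k where k: "k \<in> L" "u \<in> k" "v \<in> k" using v col_obtain_line by blast
  obtain s where s: "s \<in> P" "\<not> s \<perp> v" using nondegenerate v l line_sub by blast
  obtain z where z: "z \<in> k" "s \<perp> z" using col_line_ex k s by blast
  have "z \<noteq> v" using s z by blast
  then have "\<not> y \<perp> z" using col_line_all[OF k(1) z(1) k(3)] vy k u col_sym by blast
  then show False using key[of z v s] col_line[OF k(1) z(1) k(3)] v s z col_sym by blast
qed

lemma opposite_perp_sub_eq:
  assumes xq: "\<not> x \<perp> q" and x: "a \<perp> x" "b \<perp> x" and q: "a \<perp> q" "b \<perp> q"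
    and sub: "\<And>w. w \<perp> a \<Longrightarrow> w \<perp> x \<Longrightarrow> w \<perp> q \<Longrightarrow> w \<perp> b"
  shows "a = b"
proof (rule ccontr)
  assume ne: "a \<noteq> b"
  have step: "w \<perp> b"
    if h: "\<not> x \<perp> q" "a \<perp> x" "b \<perp> x" "a \<perp> q" "b \<perp> q"
      "\<And>w. w \<perp> a \<Longrightarrow> w \<perp> x \<Longrightarrow> w \<perp> q \<Longrightarrow> w \<perp> b" "w \<perp> a" "w \<perp> x" for x q w
  proof (cases "w = x")
    case False
    obtain m where m: "m \<in> L" "x \<in> m" "w \<in> m" using False h col_obtain_line by metis
    obtain w' where w': "w' \<in> m" "q \<perp> w'" using col_line_ex[of m q] m h col_in by metis
    have "w' \<noteq> x" using w' h col_sym by blast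
    have "a \<perp> w'" using col_line_all[OF m(1,2,3) _ _ _ w'(1)] False h col_sym by metis
    moreover have "w' \<perp> x" using m w' col_line by blast
    ultimately have "w' \<perp> b" using h w' col_sym by metis
    then show ?thesis
      using col_line_all[OF m(1) w'(1) m(2) \<open>w' \<noteq> x\<close> _ _ m(3)] h col_sym by metis
  qed (use h col_sym in metis)
  have ab: "a \<perp> b" using sub[of a] x q col_refl col_in by blast
  obtain w where w: "w \<perp> a" "\<not> w \<perp> b" using perp_sub_eq[of a b] ne x col_in by blast
  have "q \<noteq> b" using xq x col_sym by blast
  then obtain m where m: "m \<in> L" "q \<in> m" "b \<in> m" using q col_obtain_line by metis
  obtain e where e: "e \<in> m" "w \<perp> e" using col_line_ex[of m w] m w col_in by metis
  have eb: "e \<noteq> b" using e w by blast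
  have "a \<perp> e" using col_line_all[OF m(1,2,3) \<open>q \<noteq> b\<close> _ _ e(1)] q ab by blast
  moreover have "b \<perp> e" using m e col_line by blast
  moreover have "\<not> e \<perp> x"
    using col_line_all[OF m(1) e(1) m(3) eb _ _ m(2)] x xq col_sym by metis
  ultimately show False
    using step[of e x w] x w e step[OF xq x q sub] by metis
qed

text \<open>Not an axiom here. A point \<open>a\<close> of \<open>l\<close> off \<open>m\<close> is
  compared with a point \<open>b\<close> of \<open>m\<close>, both in the perp of some
  \<open>v\<close> opposite \<open>x\<close>. What is collinear with \<open>a\<close> and
  \<open>x\<close> is collinear with all of \<open>l\<close>, so with \<open>y\<close>, and so with
  all of \<open>m\<close>; \<open>opposite_perp_sub_eq\<close> for the pair \<open>x\<close>,
  \<open>v\<close> then gives \<open>a = b\<close>.\<close>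

lemma line_unique:
  assumes "l \<in> L" "m \<in> L" "x \<in> l" "y \<in> l" "x \<in> m" "y \<in> m" "x \<noteq> y"
  shows "l = m"
proof -
  have "l \<subseteq> m" if lm: "l \<in> L" "m \<in> L" "x \<in> l" "y \<in> l" "x \<in> m" "y \<in> m" for l m
  proof
    fix a assume a: "a \<in> l"
    show "a \<in> m"
    proof (rule ccontr)
      assume am: "a \<notin> m"
      then have "a \<noteq> x" using lm by blast
      then obtain v where v: "v \<perp> a" "\<not> v \<perp> x"
        using perp_sub_eq[of a x] a lm line_sub by blast
      obtain b where b: "b \<in> m" "v \<perp> b" using col_line_ex[of m v] lm v col_in by metis
      have "a = b"
      proof (rule opposite_perp_sub_eq[of x v])
        show "\<not> x \<perp> v" "a \<perp> v" "b \<perp> v" using v b col_sym by blast+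
        show "a \<perp> x" "b \<perp> x" using lm a b col_line by blast+
        fix w assume w: "w \<perp> a" "w \<perp> x"
        have "w \<perp> y" using col_line_all[OF lm(1) a lm(3) \<open>a \<noteq> x\<close>] w lm by blast
        then show "w \<perp> b" using col_line_all[OF lm(2,5,6)] w b assms by blast
      qed
      then show False using am b by blast
    qed
  qed
  then show ?thesis using assms by (meson subset_antisym)
qed

text \<open>A line equals its double perp. If \<open>q\<close> were in the double perp of
  \<open>l\<close>, the line \<open>aq\<close> would meet the perp of a point \<open>f\<close>
  opposite \<open>a\<close> in a point that \<open>opposite_perp_sub_eq\<close> identifies with
  \<open>c\<close>, so that \<open>aq\<close> would be \<open>l\<close>.\<close>

lemma line_perp_perp:
  assumes "l \<in> L" "a \<in> l" "c \<in> l" "a \<noteq> c" "q \<notin> l"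
  obtains y where "y \<perp> a" "y \<perp> c" "\<not> y \<perp> q"
proof (rule ccontr)
  assume "\<not> thesis"
  then have H: "\<And>y. y \<perp> a \<Longrightarrow> y \<perp> c \<Longrightarrow> y \<perp> q" using that by blast
  have ac: "a \<perp> a" "a \<perp> c" "c \<perp> a" using assms col_line by blast+
  have "a \<perp> q" using H ac by blast
  moreover have "a \<noteq> q" using assms by blast
  ultimately obtain k where k: "k \<in> L" "a \<in> k" "q \<in> k" using col_obtain_line by blast
  obtain f where f: "f \<perp> c" "\<not> f \<perp> a" using perp_sub_eq[of c a] ac col_in assms by blast
  obtain b where b: "b \<in> k" "f \<perp> b" using col_line_ex[of k f] k f col_in by metis
  have "c = b"
  proof (rule opposite_perp_sub_eq[of a f])
    show "\<not> a \<perp> f" "c \<perp> f" "b \<perp> f" using f b col_sym by blast+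
    show "c \<perp> a" "b \<perp> a" using ac k b col_line by blast+
    fix w assume w: "w \<perp> c" "w \<perp> a"
    then show "w \<perp> b" using H col_line_all[OF k \<open>a \<noteq> q\<close>] b by blast
  qed
  then show False using line_unique[of l k a c] assms k b by blast
qed

text \<open>
  The span of a point \<open>p\<close> and a line \<open>l\<close> inside a singular subspace, described as
  \<open>(p \<union> l)\<^sup>\<bottom>\<^sup>\<bottom>\<close>, is a cone over \<open>l\<close>.
  If the point \<open>q\<close> of the line \<open>pw\<close> collinear with some
  \<open>t \<in> l\<^sup>\<bottom> - p\<^sup>\<bottom>\<close> were not on \<open>l\<close>, a point
  \<open>s \<in> l\<^sup>\<bottom> - q\<^sup>\<bottom>\<close> could be joined to a point \<open>r\<close> of the line
  \<open>tq\<close>, and the point of the line \<open>rs\<close> collinear with \<open>p\<close> would be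
  collinear with \<open>q\<close>.
\<close>

lemma double_perp_cone:
  assumes "l \<in> L" "p \<notin> l" and pl: "\<And>a. a \<in> l \<Longrightarrow> p \<perp> a"
    and "w \<noteq> p" "w \<perp> p" and sub: "\<And>y. y \<perp> p \<Longrightarrow> (\<And>a. a \<in> l \<Longrightarrow> y \<perp> a) \<Longrightarrow> y \<perp> w"
  obtains g m where "g \<in> l" "m \<in> L" "p \<in> m" "w \<in> m" "g \<in> m"
proof -
  obtain a where a: "a \<in> l" using third_point assms(1) by metis
  obtain c where c: "c \<in> l" "a \<noteq> c" using third_point[of l a a] assms(1) by metis
  obtain t where t: "t \<perp> a" "t \<perp> c" "\<not> t \<perp> p"
    using line_perp_perp[OF assms(1) a c assms(2)] by metis
  obtain m where m: "m \<in> L" "w \<in> m" "p \<in> m" using assms col_obtain_line by metis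
  obtain q where q: "q \<in> m" "t \<perp> q" using col_line_ex[of m t] m t col_in by metis
  have subq: "y \<perp> q" if "y \<perp> p" "y \<perp> a" "y \<perp> c" for y
  proof -
    have "y \<perp> w" using sub[OF that(1)] col_line_all[OF assms(1) a c that(2,3)] by blast
    then show ?thesis using col_line_all[OF m \<open>w \<noteq> p\<close>] that q by blast
  qed
  have aq: "a \<perp> q" "c \<perp> q" using subq pl a c col_line assms(1) col_sym by metis+
  have "q \<in> l"
  proof (rule ccontr)
    assume "q \<notin> l"
    then obtain s where s: "s \<perp> a" "s \<perp> c" "\<not> s \<perp> q"
      using line_perp_perp[OF assms(1) a c] by blast
    have qp: "q \<perp> p" using m q col_line by blast
    have tq: "t \<noteq> q" using t qp by blast
    then obtain k where k: "k \<in> L" "t \<in> k" "q \<in> k" using q col_obtain_line by blast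
    obtain r where r: "r \<in> k" "s \<perp> r" using col_line_ex[of k s] k s col_in by metis
    have rq: "r \<noteq> q" using r s by blast
    have ra: "r \<perp> a" "r \<perp> c"
      using col_line_all[OF k tq _ _ r(1)] t aq col_sym by metis+
    have rp: "\<not> p \<perp> r" using col_line_all[OF k(1) r(1) k(3) rq _ _ k(2)] qp t col_sym by metis
    have rqc: "r \<perp> q" using k r col_line by blast
    have "r \<noteq> s" using rqc s by blast
    then obtain j where j: "j \<in> L" "r \<in> j" "s \<in> j" using r col_obtain_line by metis
    obtain e where e: "e \<in> j" "p \<perp> e" using col_line_ex[of j p] j pl[OF a] col_in by metis
    have "e \<perp> a" "e \<perp> c"
      using col_line_all[OF j \<open>r \<noteq> s\<close> _ _ e(1)] ra s col_sym by metis+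
    then have "q \<perp> e" using subq e col_sym by blast
    moreover have "e \<noteq> r" using e rp by blast
    ultimately have "q \<perp> s" using col_line_all[OF j(1) e(1) j(2) _ _ _ j(3)] rqc col_sym by metis
    then show False using s col_sym by blast
  qed
  then show ?thesis using that m q by blast
qed

text \<open>The Veblen-Young axiom inside singular subspaces. \<open>h\<close> is in the double perp
  of \<open>l\<close> and the line \<open>wu\<close>: collinearity with \<open>l\<close> and
  \<open>w\<close> gives \<open>c\<close>, and with \<open>c\<close> and \<open>u\<close> gives
  \<open>h\<close>. So \<open>double_perp_cone\<close> joins \<open>l\<close> and \<open>h\<close>
  by a line meeting \<open>wu\<close>.\<close>

lemma veblen:
  assumes A: "A \<in> L" "c \<in> A" "l \<in> A" "w \<in> A" and B: "B \<in> L" "c \<in> B" "h \<in> B" "u \<in> B"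
    and AB: "A \<noteq> B" "\<And>a b. a \<in> A \<Longrightarrow> b \<in> B \<Longrightarrow> a \<perp> b"
    and ne: "l \<noteq> w" "l \<noteq> c" "w \<noteq> c" "h \<noteq> c" "u \<noteq> c"
  obtains v m k where "m \<in> L" "l \<in> m" "h \<in> m" "v \<in> m" "k \<in> L" "w \<in> k" "u \<in> k" "v \<in> k"
proof -
  have notA: "u \<notin> A" "h \<notin> A" using line_unique[of A B c] A B AB ne by metis+
  have "w \<noteq> u" using notA A by blast
  then obtain k where k: "k \<in> L" "w \<in> k" "u \<in> k" using AB A B col_obtain_line by metis
  have lk: "l \<notin> k" using line_unique[of k A l w] k A ne notA by metis
  have lw: "l \<perp> w" "l \<perp> u" using A B AB col_line by blast+
  have h: "h \<noteq> l" "h \<perp> l" using notA A B AB col_sym by blast+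
  show ?thesis
  proof (rule double_perp_cone[OF k(1) lk _ h])
    show "l \<perp> a" if "a \<in> k" for a using col_line_all[OF k \<open>w \<noteq> u\<close> lw that] .
    show "y \<perp> h" if y: "y \<perp> l" "\<And>a. a \<in> k \<Longrightarrow> y \<perp> a" for y
    proof -
      have "y \<perp> c" by (rule col_line_all[OF A(1,3,4) ne(1) y(1) y(2)[OF k(2)] A(2)])
      then show ?thesis by (rule col_line_all[OF B(1,4,2) ne(5) y(2)[OF k(3)] _ B(3)])
    qed
    fix g m assume "g \<in> k" "m \<in> L" "l \<in> m" "h \<in> m" "g \<in> m"
    then show thesis using that k by blast
  qed
qed

subsection \<open>Generation of singular subspaces\<close>

lemma subspaceI:
  assumes "S \<subseteq> P"
    and "\<And>l x y z. l \<in> L \<Longrightarrow> x \<in> l \<Longrightarrow> y \<in> l \<Longrightarrow> x \<in> S \<Longrightarrow> y \<in> S \<Longrightarrow> x \<noteq> y \<Longrightarrow> z \<in> l \<Longrightarrow> z \<in> S"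
  shows "geom_subspace P L S"
  using assms unfolding geom_subspace_def by blast

lemma subspaceD:
  assumes "geom_subspace P L S" "l \<in> L" "x \<in> l" "y \<in> l" "x \<in> S" "y \<in> S" "x \<noteq> y"
  shows "l \<subseteq> S"
  using assms unfolding geom_subspace_def by blast

lemma line_subspace: "l \<in> L \<Longrightarrow> geom_subspace P L l"
  by (rule subspaceI) (use line_sub line_unique in blast)+

lemma line_singular: "l \<in> L \<Longrightarrow> singular l"
  using line_subspace col_line unfolding singular_subspace_def by blast

lemma gen_incl: "X \<subseteq> gen X"
  unfolding generated_def by blast

lemma gen_least: "geom_subspace P L S \<Longrightarrow> X \<subseteq> S \<Longrightarrow> gen X \<subseteq> S"
  unfolding generated_def by blast

lemma gen_subspace: "X \<subseteq> P \<Longrightarrow> geom_subspace P L (gen X)"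
proof (rule subspaceI)
  assume "X \<subseteq> P"
  moreover have "geom_subspace P L P" using line_sub by (intro subspaceI) auto
  ultimately show "gen X \<subseteq> P" by (rule gen_least[rotated])
next
  fix l x y z
  assume "l \<in> L" "x \<in> l" "y \<in> l" "x \<in> gen X" "y \<in> gen X" "x \<noteq> y" "z \<in> l"
  then have "z \<in> S" if "geom_subspace P L S" "X \<subseteq> S" for S
    using subspaceD[OF that(1), of l x y] that unfolding generated_def by blast
  then show "z \<in> gen X" unfolding generated_def by blast
qed

lemma gen_mono: "X \<subseteq> Y \<Longrightarrow> gen X \<subseteq> gen Y"
  unfolding generated_def by blast

lemma gen_sub_P: "X \<subseteq> P \<Longrightarrow> gen X \<subseteq> P"
  using gen_subspace unfolding geom_subspace_def by blast

lemma gen_sub_perp: "(\<And>x. x \<in> X \<Longrightarrow> z \<perp> x) \<Longrightarrow> z \<in> P \<Longrightarrow> u \<in> gen X \<Longrightarrow> z \<perp> u"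
  using gen_least[OF perp_subspace, of z X] by (auto simp: perp_def)

lemma gen_singular:
  assumes "X \<subseteq> P" "\<And>x y. x \<in> X \<Longrightarrow> y \<in> X \<Longrightarrow> x \<perp> y"
  shows "singular (gen X)"
  unfolding singular_subspace_def
proof (intro conjI ballI)
  show "geom_subspace P L (gen X)" using assms gen_subspace by blast
  fix u v assume u: "u \<in> gen X" and v: "v \<in> gen X"
  have "x \<perp> u" if "x \<in> X" for x using gen_sub_perp[of X x u] u that assms by blast
  then show "u \<perp> v"
    using gen_sub_perp[of X u v] v u gen_sub_P assms(1) col_sym by blast
qed

lemma singular_col: "singular S \<Longrightarrow> x \<in> S \<Longrightarrow> y \<in> S \<Longrightarrow> x \<perp> y"
  unfolding singular_subspace_def by blast

lemma singular_sub: "singular S \<Longrightarrow> geom_subspace P L S"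
  unfolding singular_subspace_def by blast

lemma singular_P: "singular S \<Longrightarrow> S \<subseteq> P"
  unfolding singular_subspace_def geom_subspace_def by blast

lemma gen_empty: "gen {} = {}"
  using gen_least[of "{}" "{}"] by (auto simp: geom_subspace_def)

lemma gen_single: "x \<in> P \<Longrightarrow> gen {x} = {x}"
  using gen_least[of "{x}" "{x}"] gen_incl[of "{x}"] by (auto simp: geom_subspace_def)

lemma singular_single: "x \<in> P \<Longrightarrow> singular {x}"
  using gen_singular[of "{x}"] gen_single col_refl by auto

lemma gen_pair: "l \<in> L \<Longrightarrow> x \<in> l \<Longrightarrow> y \<in> l \<Longrightarrow> x \<noteq> y \<Longrightarrow> gen {x, y} = l"
  by (rule subset_antisym)
    (use gen_least[OF line_subspace] subspaceD[OF gen_subspace] gen_incl[of "{x, y}"] line_sub in auto)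

text \<open>The lines joining \<open>x\<close> to \<open>gen X\<close>, together with
  \<open>x\<close>, already form a subspace: two cone points on a line missing \<open>x\<close> lie
  over two points \<open>s1\<close>, \<open>s2\<close> of the base, and their line stays in the cone
  over the line \<open>s1 s2\<close> by \<open>double_perp_cone\<close>.\<close>

lemma gen_insert_cone:
  assumes X: "X \<subseteq> P" "\<And>a b. a \<in> X \<Longrightarrow> b \<in> X \<Longrightarrow> a \<perp> b"
    and x: "x \<in> P" "\<And>a. a \<in> X \<Longrightarrow> x \<perp> a" "x \<notin> gen X"
    and z: "z \<in> gen (insert x X)" "z \<noteq> x"
  obtains s m where "s \<in> gen X" "m \<in> L" "x \<in> m" "s \<in> m" "z \<in> m"
proof -
  define S where "S = gen X"
  have S: "singular S" using gen_singular X unfolding S_def by blast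
  have xS: "x \<perp> s" if "s \<in> S" for s using gen_sub_perp x that unfolding S_def by blast
  define C where "C = {z. \<exists>s\<in>S. \<exists>m\<in>L. x \<in> m \<and> s \<in> m \<and> z \<in> m}"
  have CP: "C \<subseteq> P" unfolding C_def using line_sub by blast
  have "geom_subspace P L (insert x C)"
  proof (rule subspaceI)
    show "insert x C \<subseteq> P" using CP x by blast
    fix l u v w
    assume l: "l \<in> L" "u \<in> l" "v \<in> l" "u \<in> insert x C" "v \<in> insert x C" "u \<noteq> v" "w \<in> l"
    have xl: "w \<in> insert x C" if a: "x \<in> l" "a \<in> l" "a \<in> C" "a \<noteq> x" for a
    proof -
      obtain s m where "s \<in> S" "m \<in> L" "x \<in> m" "s \<in> m" "a \<in> m" using a unfolding C_def by blast
      moreover from this have "m = l" using line_unique l a by metis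
      ultimately show ?thesis using l unfolding C_def by blast
    qed
    show "w \<in> insert x C"
    proof (cases "x \<in> l")
      case True
      then show ?thesis using xl[of u] xl[of v] l by blast
    next
      case False
      then have "u \<in> C" "v \<in> C" using l by auto
      then obtain s1 m1 s2 m2 where s: "s1 \<in> S" "m1 \<in> L" "x \<in> m1" "s1 \<in> m1" "u \<in> m1"
        "s2 \<in> S" "m2 \<in> L" "x \<in> m2" "s2 \<in> m2" "v \<in> m2" unfolding C_def by blast
      have "x \<noteq> s1" "x \<noteq> s2" using s x unfolding S_def by auto
      then have "s1 \<noteq> s2" using line_unique[of m1 m2 x s1] line_unique[of m1 l u v] s l False by metis
      then obtain k where k: "k \<in> L" "s1 \<in> k" "s2 \<in> k" using singular_col[OF S] s col_obtain_line by metis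
      have kS: "k \<subseteq> S" using subspaceD[OF singular_sub[OF S] k] s \<open>s1 \<noteq> s2\<close> by blast
      have "x \<perp> u" "x \<perp> v" using s col_line by blast+
      then have xw: "w \<perp> x" using col_line_all[OF l(1-3,6)] l col_sym by metis
      have "w \<noteq> x" using False l by blast
      have "x \<notin> k" using kS x unfolding S_def by blast
      show ?thesis
      proof (rule double_perp_cone[OF k(1) \<open>x \<notin> k\<close> _ \<open>w \<noteq> x\<close> xw])
        show "x \<perp> a" if "a \<in> k" for a using that kS xS by blast
        fix y assume y: "y \<perp> x" "\<And>a. a \<in> k \<Longrightarrow> y \<perp> a"
        have "y \<perp> u" by (rule col_line_all[OF s(2-4) \<open>x \<noteq> s1\<close> y(1) y(2)[OF k(2)] s(5)])
        moreover have "y \<perp> v" by (rule col_line_all[OF s(7-9) \<open>x \<noteq> s2\<close> y(1) y(2)[OF k(3)] s(10)])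
        ultimately show "y \<perp> w" using col_line_all[OF l(1-3,6)] l by blast
      next
        fix g m assume "g \<in> k" "m \<in> L" "x \<in> m" "w \<in> m" "g \<in> m"
        then show ?thesis using kS unfolding C_def by blast
      qed
    qed
  qed
  moreover have "insert x X \<subseteq> insert x C"
  proof -
    have "a \<in> C" if "a \<in> X" for a
    proof -
      have a: "a \<in> S" using that gen_incl unfolding S_def by blast
      then have "x \<noteq> a" using x S_def by blast
      then obtain l where "l \<in> L" "x \<in> l" "a \<in> l" using xS[OF a] col_obtain_line by blast
      then show ?thesis using a unfolding C_def by blast
    qed
    then show ?thesis by blast
  qed
  ultimately have "z \<in> C" using gen_least z by blast
  then show ?thesis using that unfolding C_def S_def by blast
qed

text \<open>Projecting the other generators from a generator not collinear with \<open>b\<close>.\<close>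

lemma perp_section_generators:
  assumes X: "finite X" "X \<subseteq> P" "\<And>x y. x \<in> X \<Longrightarrow> y \<in> X \<Longrightarrow> x \<perp> y"
    and b: "b \<in> P" and a: "a \<in> gen X" "\<not> a \<perp> b"
  obtains Y where "finite Y" "Y \<subseteq> P" "\<And>x y. x \<in> Y \<Longrightarrow> y \<in> Y \<Longrightarrow> x \<perp> y" "card Y < card X"
    "\<And>z. z \<in> gen X \<Longrightarrow> z \<perp> b \<Longrightarrow> z \<in> gen Y"
proof -
  obtain x0 where x0: "x0 \<in> X" "\<not> x0 \<perp> b"
    using gen_sub_perp[of X b a] a b col_sym by blast
  have S: "singular (gen X)" using gen_singular X by blast
  have "\<exists>y l. l \<in> L \<and> x0 \<in> l \<and> x \<in> l \<and> y \<in> l \<and> b \<perp> y" if x: "x \<in> X - {x0}" for x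
  proof -
    obtain l where l: "l \<in> L" "x0 \<in> l" "x \<in> l" using X x x0 col_obtain_line[of x0 x] by blast
    moreover obtain y where "y \<in> l" "b \<perp> y" using col_line_ex[OF l(1) b] .
    ultimately show ?thesis by metis
  qed
  then obtain f l where f: "\<And>x. x \<in> X - {x0} \<Longrightarrow> l x \<in> L \<and> x0 \<in> l x \<and> x \<in> l x \<and> f x \<in> l x \<and> b \<perp> f x"
    by metis
  define Y where "Y = f ` (X - {x0})"
  have YX: "Y \<subseteq> gen X"
  proof
    fix y assume "y \<in> Y"
    then obtain x where x: "x \<in> X - {x0}" "y = f x" unfolding Y_def by blast
    have "l x \<subseteq> gen X"
      using subspaceD[OF singular_sub[OF S], of "l x" x0 x] f[OF x(1)] x x0 gen_incl by blast
    then show "y \<in> gen X" using x f by blast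
  qed
  have Y: "finite Y" "Y \<subseteq> P" using X(1) f col_in(2) unfolding Y_def by blast+
  have Yb: "b \<perp> y" if "y \<in> gen Y" for y
    using gen_sub_perp[of Y b y] that b f unfolding Y_def by blast
  have Yc: "x \<perp> y" if "x \<in> Y" "y \<in> Y" for x y using YX singular_col[OF S] that by blast
  have Y0: "x0 \<perp> y" if "y \<in> Y" for y using YX singular_col[OF S] that x0 gen_incl by blast
  have x0Y: "x0 \<notin> gen Y" using Yb x0 col_sym by blast
  have x0P: "x0 \<in> P" using x0 X by blast
  have "X \<subseteq> gen (insert x0 Y)"
  proof
    fix x assume x: "x \<in> X"
    show "x \<in> gen (insert x0 Y)"
    proof (cases "x = x0")
      case False
      then have x': "x \<in> X - {x0}" using x by blast
      have "insert x0 Y \<subseteq> gen (insert x0 Y)" by (rule gen_incl)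
      moreover have "f x \<in> Y" using x' unfolding Y_def by (rule imageI)
      moreover have "f x \<noteq> x0" using f[OF x'] x0 col_sym by metis
      ultimately have "l x \<subseteq> gen (insert x0 Y)"
        using subspaceD[OF gen_subspace, of "insert x0 Y" "l x" "f x" x0] f[OF x'] x0P Y
        by (metis insert_subset insertI1 insertI2 subsetD)
      then show ?thesis using f[OF x'] by blast
    qed (use gen_incl in blast)
  qed
  then have sub: "gen X \<subseteq> gen (insert x0 Y)"
    using gen_least gen_subspace[of "insert x0 Y"] x0P Y by blast
  have "z \<in> gen Y" if z: "z \<in> gen X" "z \<perp> b" for z
  proof -
    have "z \<noteq> x0" using z x0 by blast
    then obtain s m where s: "s \<in> gen Y" "m \<in> L" "x0 \<in> m" "s \<in> m" "z \<in> m"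
      using gen_insert_cone[OF Y(2) Yc x0P Y0 x0Y, of z] sub z by blast
    have "z = s"
    proof (rule ccontr)
      assume "z \<noteq> s"
      then have "b \<perp> x0" using col_line_all[OF s(2,5,4) _ _ _ s(3)] Yb s(1) z col_sym by blast
      then show False using x0 col_sym by blast
    qed
    then show ?thesis using s by blast
  qed
  moreover have "card Y < card X"
  proof -
    have "card Y \<le> card (X - {x0})" unfolding Y_def using X by (intro card_image_le) auto
    also have "\<dots> < card X" using X x0 by (meson card_Diff1_less)
    finally show ?thesis .
  qed
  ultimately show ?thesis using that[of Y] Y Yc by blast
qed

text \<open>A substitute for linear independence. All \<open>a i\<close> except \<open>a m\<close>
  are in the perp of \<open>b m\<close>, while \<open>a m\<close> is not, so they lie in a section
  generated by fewer points; the induction removes one dual pair at a time.\<close>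

lemma dual_family_card_le:
  assumes "finite I" "finite X" "X \<subseteq> P" "\<And>x y. x \<in> X \<Longrightarrow> y \<in> X \<Longrightarrow> x \<perp> y"
    and "\<And>i. i \<in> I \<Longrightarrow> a i \<in> gen X \<and> b i \<in> P"
    and "\<And>i j. i \<in> I \<Longrightarrow> j \<in> I \<Longrightarrow> a i \<perp> b j \<longleftrightarrow> i \<noteq> j"
  shows "card I \<le> card X"
  using assms
proof (induction I arbitrary: X rule: finite_induct)
  case (insert m I)
  obtain Y where Y: "finite Y" "Y \<subseteq> P" "\<And>x y. x \<in> Y \<Longrightarrow> y \<in> Y \<Longrightarrow> x \<perp> y" "card Y < card X"
    "\<And>z. z \<in> gen X \<Longrightarrow> z \<perp> b m \<Longrightarrow> z \<in> gen Y"
    by (rule perp_section_generators[of X "b m" "a m"]) (use insert.prems in auto)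
  have "card I \<le> card Y"
  proof (rule insert.IH[OF Y(1-3)])
    fix i assume i: "i \<in> I"
    then have "a i \<perp> b m" using insert.prems(5)[of i m] insert.hyps by auto
    then show "a i \<in> gen Y \<and> b i \<in> P" using Y(5) insert.prems(4) i by blast
  qed (use insert.prems(5) in auto)
  then show ?case using Y insert.hyps by simp
qed simp

lemma singular_in_maximal:
  assumes "singular S" obtains M where "maximal_singular P L M" "S \<subseteq> M"
proof -
  define A where "A = {T. singular T \<and> S \<subseteq> T}"
  have "\<exists>M\<in>A. \<forall>X\<in>A. M \<subseteq> X \<longrightarrow> X = M"
  proof (rule subset_Zorn_nonempty)
    show "A \<noteq> {}" using assms unfolding A_def by blast
    fix C assume C: "C \<noteq> {}" "subset.chain A C"
    have sing: "singular T" "S \<subseteq> T" if "T \<in> C" for T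
      using C that unfolding A_def subset_chain_def by blast+
    have two: "\<exists>T\<in>C. x \<in> T \<and> y \<in> T" if "x \<in> \<Union>C" "y \<in> \<Union>C" for x y
      using C that unfolding subset_chain_def by blast
    have "geom_subspace P L (\<Union>C)"
    proof (rule subspaceI)
      show "\<Union>C \<subseteq> P" using sing singular_P by blast
      fix l x y z
      assume l: "l \<in> L" "x \<in> l" "y \<in> l" "x \<in> \<Union>C" "y \<in> \<Union>C" "x \<noteq> y" "z \<in> l"
      then obtain T where T: "T \<in> C" "x \<in> T" "y \<in> T" using two by blast
      then have "l \<subseteq> T" using subspaceD[OF singular_sub[OF sing(1)]] l by metis
      then show "z \<in> \<Union>C" using T l by blast
    qed
    moreover have "\<forall>x\<in>\<Union>C. \<forall>y\<in>\<Union>C. x \<perp> y" using two sing singular_col by metis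
    ultimately have "singular (\<Union>C)" unfolding singular_subspace_def by blast
    then show "\<Union>C \<in> A" using sing C unfolding A_def by blast
  qed
  then obtain M where M: "singular M" "S \<subseteq> M" "\<And>X. singular X \<Longrightarrow> M \<subseteq> X \<Longrightarrow> X = M"
    unfolding A_def by (smt (verit) mem_Collect_eq subset_trans)
  then have "maximal_singular P L M" unfolding maximal_singular_def by metis
  then show ?thesis using M(2) by (rule that)
qed

text \<open>Turns coplanarity into a condition on one pair of points. When
  \<open>x \<perp> x'\<close> the span of \<open>c\<close>, \<open>x\<close>, \<open>x'\<close> is
  singular, and it needs three generators because two collinear points only generate a line, which
  would be both \<open>K\<close> and \<open>K'\<close>.\<close>

lemma coplanar_lines_iff:
  assumes K: "K \<in> L" "K' \<in> L" "K \<noteq> K'" "c \<in> K" "c \<in> K'" "x \<in> K" "x' \<in> K'" "x \<noteq> c" "x' \<noteq> c"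
  shows "coplanar_lines P L K K' \<longleftrightarrow> x \<perp> x'"
proof
  assume "coplanar_lines P L K K'"
  then show "x \<perp> x'" using K singular_col unfolding coplanar_lines_def sing_plane_def by blast
next
  assume xx: "x \<perp> x'"
  define S where "S = gen {c, x, x'}"
  have ne: "x \<noteq> x'" using line_unique K by metis
  have XP: "{c, x, x'} \<subseteq> P" using K line_sub by blast
  have S: "singular S" unfolding S_def
    using XP xx col_sym[of x x'] col_refl col_line[OF K(1)] col_line[OF K(2)] K
    by (intro gen_singular) auto
  have "{c, x, x'} \<subseteq> S" using gen_incl unfolding S_def .
  then have KS: "K \<subseteq> S" "K' \<subseteq> S"
    using subspaceD[OF singular_sub[OF S], of K c x] subspaceD[OF singular_sub[OF S], of K' c x'] K by auto
  have "3 \<le> card X" if X: "X \<subseteq> P" "finite X" "gen X = S" for X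
  proof (rule ccontr)
    assume "\<not> 3 \<le> card X"
    then consider "card X = 0" | "card X = 1" | "card X = 2" by linarith
    then show False
    proof cases
      case 1
      then show ?thesis using X gen_empty KS K by auto
    next
      case 2
      then obtain a where "X = {a}" by (auto simp: card_1_singleton_iff)
      then have "S = {a}" using X gen_single by auto
      then show ?thesis using KS K by blast
    next
      case 3
      then obtain a b where ab: "X = {a, b}" "a \<noteq> b" by (auto simp: card_2_iff)
      then have "a \<perp> b" using singular_col[OF S] gen_incl[of X] X by blast
      then obtain l where "l \<in> L" "a \<in> l" "b \<in> l" using ab col_obtain_line by blast
      then have "l \<in> L" "S = l" using gen_pair X ab by auto
      then show ?thesis using line_unique[of K l c x] line_unique[of K' l c x'] K KS by blast
    qed
  qed
  moreover have "card {c, x, x'} = 3" using K ne by simp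
  ultimately have "min_generators P L S 3"
    unfolding min_generators_def using XP S_def by (intro conjI exI[of _ "{c, x, x'}"]) auto
  then show "coplanar_lines P L K K'" using S KS unfolding coplanar_lines_def sing_plane_def by blast
qed

subsection \<open>Polar frames\<close>

text \<open>The common perp of an opposite pair has no radical: a point \<open>t\<close> collinear
  with \<open>a\<close> but not with \<open>x\<close> is pushed along the line \<open>ta\<close>
  into the perp of \<open>b\<close>, and it stays opposite \<open>x\<close> because \<open>a\<close>
  is collinear with \<open>x\<close>.\<close>

lemma opposite_perp_nondegenerate:
  assumes "\<not> a \<perp> b" "x \<perp> a" "x \<perp> b"
  obtains s where "s \<perp> a" "s \<perp> b" "\<not> s \<perp> x"
proof -
  have "a \<noteq> x" using assms by blast
  then obtain t where t: "t \<perp> a" "\<not> t \<perp> x" using perp_sub_eq[of a x] assms col_in by blast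
  then have "t \<noteq> a" using assms col_sym by blast
  then obtain l where l: "l \<in> L" "t \<in> l" "a \<in> l" using t col_obtain_line by blast
  obtain s where s: "s \<in> l" "b \<perp> s" using col_line_ex[of l b] l assms col_in by metis
  have "s \<noteq> a" using s assms col_sym by blast
  then have "\<not> s \<perp> x"
    using col_line_all[OF l(1) s(1) l(3) _ _ _ l(2)] assms t col_sym by metis
  then show ?thesis using that s l col_line col_sym by metis
qed

text \<open>The smaller polar space for induction on frames. A line with two points in
  \<open>R\<close> lies in \<open>R\<close>, so collinearity is inherited. \<open>M\<close> may be
  empty, which \<open>polar_space\<close> allows, so low rank is no exception.\<close>

lemma perp_pair:
  assumes ab: "\<not> a \<perp> b" "a \<in> P" "b \<in> P"
  defines "R \<equiv> perp P L a \<inter> perp P L b"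
  defines "M \<equiv> {l \<in> L. l \<subseteq> R}"
  shows perp_pair_col: "collinear_pts R M x y \<longleftrightarrow> x \<in> R \<and> y \<in> R \<and> x \<perp> y"
    and perp_pair_polar_space: "polar_space R M"
proof -
  have R: "x \<in> R \<longleftrightarrow> x \<perp> a \<and> x \<perp> b" for x unfolding R_def perp_def using col_sym by auto
  have RS: "l \<subseteq> R" if "l \<in> L" "u \<in> l" "v \<in> l" "u \<in> R" "v \<in> R" "u \<noteq> v" for l u v
    using col_line_all[OF that(1-3,6)] that(4,5) R col_sym by blast
  have col: "collinear_pts R M x y \<longleftrightarrow> x \<in> R \<and> y \<in> R \<and> x \<perp> y" for x y
  proof
    assume "collinear_pts R M x y"
    then show "x \<in> R \<and> y \<in> R \<and> x \<perp> y"
      unfolding collinear_pts_def M_def using R col_in by blast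
  next
    assume h: "x \<in> R \<and> y \<in> R \<and> x \<perp> y"
    show "collinear_pts R M x y"
    proof (cases "x = y")
      case False
      then obtain l where l: "l \<in> L" "x \<in> l" "y \<in> l" using h col_obtain_line by blast
      then have "l \<in> M" using RS[OF l] h False unfolding M_def by blast
      then show ?thesis using h l unfolding collinear_pts_def by blast
    qed (use h in \<open>simp add: collinear_pts_def\<close>)
  qed
  then show "collinear_pts R M x y \<longleftrightarrow> x \<in> R \<and> y \<in> R \<and> x \<perp> y" .
  have "proper_hyperplane R M (perp R M x)" if x: "x \<in> R" for x
  proof -
    have pe: "perp R M x = {y \<in> R. x \<perp> y}" using col x unfolding perp_def by auto
    have "geom_subspace R M (perp R M x)"
      unfolding geom_subspace_def pe unfolding M_def using col_line_all by blast
    moreover have "l \<inter> perp R M x \<noteq> {}" if l: "l \<in> M" for l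
    proof -
      have "l \<in> L" "x \<in> P" using l x R col_in unfolding M_def by blast+
      then obtain u where "u \<in> l" "x \<perp> u" by (rule col_line_ex)
      then show ?thesis using l unfolding pe unfolding M_def by blast
    qed
    moreover have "perp R M x \<noteq> R"
    proof -
      obtain s where "s \<perp> a" "s \<perp> b" "\<not> s \<perp> x"
        using opposite_perp_nondegenerate[of a b x] ab x R by blast
      then show ?thesis using R col_sym unfolding pe by blast
    qed
    ultimately show ?thesis unfolding proper_hyperplane_def geom_hyperplane_def by blast
  qed
  moreover have "\<exists>T\<subseteq>l. card T = 3" if "l \<in> M" for l
    using that polar unfolding M_def polar_space_def by blast
  ultimately show "polar_space R M"
    unfolding polar_space_def point_line_geometry_def using M_def by blast
qed

end

lemma frame_index_Suc: "frame_index (Suc m) = insert (int (Suc m)) (insert (- int (Suc m)) (frame_index m))"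
  by (auto simp: frame_index_def)

lemma frame_index_uminus [simp]: "- i \<in> frame_index n \<longleftrightarrow> i \<in> frame_index n"
  by (auto simp: frame_index_def)

lemma finite_frame_index [simp]: "finite (frame_index n)"
  by (rule finite_subset[of _ "{- int n..int n}"]) (auto simp: frame_index_def)

lemma card_frame_index: "card (frame_index n) = 2 * n"
proof (induction n)
  case (Suc n)
  have "int (Suc n) \<notin> insert (- int (Suc n)) (frame_index n)" "- int (Suc n) \<notin> frame_index n"
    by (auto simp: frame_index_def)
  then show ?case using Suc unfolding frame_index_Suc by simp
qed (simp add: frame_index_def)

text \<open>Splitting off the last opposite pair \<open>a\<close>, \<open>b\<close> leaves a shorter
  frame in the polar space on their common perp, hence the induction over all \<open>P\<close> and
  \<open>L\<close>. At \<open>m = 0\<close> the claim is nondegeneracy of the space reached.\<close>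

lemma frame_nondegenerate:
  assumes "polar_space P L" "polar_frame P L m p" "z \<in> P"
    "\<forall>k\<in>frame_index m. collinear_pts P L z (p k)"
  shows "\<exists>z'\<in>P. (\<forall>k\<in>frame_index m. collinear_pts P L z' (p k)) \<and> \<not> collinear_pts P L z' z"
  using assms
proof (induction m arbitrary: P L)
  case 0
  then interpret polar P L by unfold_locales
  show ?case using nondegenerate 0 by (auto simp: frame_index_def)
next
  case (Suc m)
  then interpret polar P L by unfold_locales
  define a b where "a = p (int (Suc m))" and "b = p (- int (Suc m))"
  define R where "R = perp P L a \<inter> perp P L b"
  define M where "M = {l \<in> L. l \<subseteq> R}"
  let ?i = "int (Suc m)" and ?c = "collinear_pts P L"
  have idx: "?i \<in> frame_index (Suc m)" "- ?i \<in> frame_index (Suc m)"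
    "frame_index m \<subseteq> frame_index (Suc m)" by (auto simp: frame_index_def)
  have fr: "\<And>i j. i \<in> frame_index (Suc m) \<Longrightarrow> j \<in> frame_index (Suc m) \<Longrightarrow> ?c (p i) (p j) \<longleftrightarrow> i + j \<noteq> 0"
    "p ` frame_index (Suc m) \<subseteq> P" "inj_on p (frame_index (Suc m))"
    using Suc.prems(2) unfolding polar_frame_def by blast+
  have "\<not> ?c a b" using fr(1)[OF idx(1,2)] unfolding a_def b_def by simp
  moreover have "a \<in> P" "b \<in> P" using fr idx unfolding a_def b_def by blast+
  ultimately have ps: "polar_space R M" and
    col: "\<And>x y. collinear_pts R M x y \<longleftrightarrow> x \<in> R \<and> y \<in> R \<and> ?c x y"
    unfolding R_def M_def using perp_pair_polar_space perp_pair_col by blast+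
  have R: "x \<in> R \<longleftrightarrow> ?c x a \<and> ?c x b" for x unfolding R_def perp_def using col_sym by auto
  have pR: "p k \<in> R" if "k \<in> frame_index m" for k
  proof -
    have "k \<in> frame_index (Suc m)" "k + ?i \<noteq> 0" "k + - ?i \<noteq> 0"
      using that by (auto simp: frame_index_def)
    then show ?thesis using fr(1) idx(1,2) unfolding R a_def b_def by blast
  qed
  have zR: "z \<in> R" using Suc.prems(4) idx unfolding R a_def b_def by blast
  have "polar_frame R M m p"
    unfolding polar_frame_def col
  proof (intro conjI ballI)
    fix i j assume "i \<in> frame_index m" "j \<in> frame_index m"
    then show "(p i \<in> R \<and> p j \<in> R \<and> ?c (p i) (p j)) = (i + j \<noteq> 0)" using pR fr(1)[of i j] idx(3) by blast
  qed (use pR inj_on_subset[OF fr(3) idx(3)] in blast)+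
  moreover have "\<forall>k\<in>frame_index m. collinear_pts R M z (p k)"
    using Suc.prems(4) idx(3) pR zR unfolding col by blast
  ultimately have "\<exists>z'\<in>R. (\<forall>k\<in>frame_index m. collinear_pts R M z' (p k)) \<and> \<not> collinear_pts R M z' z"
    using Suc.IH[OF ps] zR by blast
  then obtain z' where z': "z' \<in> R" "\<And>k. k \<in> frame_index m \<Longrightarrow> ?c z' (p k)" "\<not> ?c z' z"
    unfolding col using zR by blast
  then have "\<forall>k\<in>frame_index (Suc m). ?c z' (p k)"
    unfolding frame_index_Suc using R a_def b_def by auto
  then show ?case using z' R col_in by blast
qed

lemma (in polar) frame_add_pair:
  assumes fr: "polar_frame P L m p"
    and z: "\<forall>k\<in>frame_index m. z \<perp> p k" "\<forall>k\<in>frame_index m. z' \<perp> p k"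
    and zz: "z \<in> P" "z' \<in> P" "\<not> z \<perp> z'"
  shows "polar_frame P L (Suc m) (p(int (Suc m) := z, - int (Suc m) := z'))"
    (is "polar_frame P L _ ?q")
proof -
  let ?i = "int (Suc m)"
  have ne: "z \<noteq> z'" "\<not> z' \<perp> z" using zz col_refl col_sym by blast+
  have q: "?q ?i = z" "?q (- ?i) = z'" "\<And>k. k \<in> frame_index m \<Longrightarrow> ?q k = p k"
    by (auto simp: frame_index_def)
  have p: "p ` frame_index m \<subseteq> P" "inj_on p (frame_index m)"
    "\<And>i j. i \<in> frame_index m \<Longrightarrow> j \<in> frame_index m \<Longrightarrow> p i \<perp> p j \<longleftrightarrow> i + j \<noteq> 0"
    using fr unfolding polar_frame_def by blast+
  have ni: "i + ?i \<noteq> 0" "?i + i \<noteq> 0" "i + - ?i \<noteq> 0" "- ?i + i \<noteq> 0" if "i \<in> frame_index m" for i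
    using that by (auto simp: frame_index_def)
  have c: "?q i \<perp> ?q j \<longleftrightarrow> i + j \<noteq> 0" if "i \<in> frame_index (Suc m)" "j \<in> frame_index (Suc m)" for i j
    using that zz(3) ne z p(3) ni col_refl[OF zz(1)] col_refl[OF zz(2)]
    unfolding frame_index_Suc insert_iff by (elim disjE; simp only: q) (simp_all add: col_sym)
  have "?q i \<noteq> ?q j" if "i \<in> frame_index (Suc m)" "j \<in> frame_index (Suc m)" "i \<noteq> j" for i j
    using c[of i "-i"] c[of j "-i"] that by auto
  then have "inj_on ?q (frame_index (Suc m))" by (meson inj_onI)
  moreover have "?q ` frame_index (Suc m) \<subseteq> P"
  proof (rule image_subsetI)
    fix i assume i: "i \<in> frame_index (Suc m)"
    moreover have "i + i \<noteq> 0" using i by (simp add: frame_index_def)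
    ultimately show "?q i \<in> P" using c[OF i i] col_in by blast
  qed
  ultimately show ?thesis unfolding polar_frame_def using c by blast
qed

context polar begin

lemma frame_in: "polar_frame P L m p \<Longrightarrow> i \<in> frame_index m \<Longrightarrow> p i \<in> P"
  unfolding polar_frame_def by blast

lemma frame_sub: "polar_frame P L m p \<Longrightarrow> p ` frame_index m \<subseteq> P"
  unfolding polar_frame_def by blast

lemma frame_col:
  "polar_frame P L m p \<Longrightarrow> i \<in> frame_index m \<Longrightarrow> j \<in> frame_index m \<Longrightarrow> p i \<perp> p j \<longleftrightarrow> i + j \<noteq> 0"
  unfolding polar_frame_def by blast

lemma frame_card: "polar_frame P L m p \<Longrightarrow> card (p ` frame_index m) = 2 * m"
  unfolding polar_frame_def by (simp add: card_image card_frame_index)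

lemma frame_half_singular:
  assumes "polar_frame P L m p"
  shows "singular (gen (p ` {1..int m}))"
proof -
  have "{1..int m} \<subseteq> frame_index m" by (auto simp: frame_index_def)
  then show ?thesis
    using frame_in[OF assms] frame_col[OF assms]
    by (intro gen_singular) (auto simp: subset_iff)
qed

text \<open>In a maximal singular subspace containing the positive half of the frame, the points
  \<open>p i\<close> are dual to the points \<open>p (- i)\<close>. So
  \<open>dual_family_card_le\<close> compares \<open>m\<close> with a generating set of
  \<open>n\<close> points.\<close>

lemma frame_le_rank:
  assumes rank: "has_finite_rank P L n" and fr: "polar_frame P L m p"
  shows "m \<le> n"
proof -
  obtain M where M: "maximal_singular P L M" "gen (p ` {1..int m}) \<subseteq> M"
    using singular_in_maximal[OF frame_half_singular[OF fr]] .
  then obtain X where X: "X \<subseteq> P" "finite X" "card X = n" "gen X = M"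
    using rank unfolding has_finite_rank_def min_generators_def by blast
  have "singular M" using M unfolding maximal_singular_def by blast
  have idx: "i \<in> frame_index m" "- i \<in> frame_index m" if "i \<in> {1..int m}" for i
    using that by (auto simp: frame_index_def)
  have "card {1..int m} \<le> card X"
  proof (rule dual_family_card_le[where a = p and b = "\<lambda>i. p (- i)"])
    fix i assume "i \<in> {1..int m}"
    then show "p i \<in> gen X \<and> p (- i) \<in> P"
      using frame_in[OF fr] idx M(2) X(4) gen_incl[of "p ` {1..int m}"] by blast
  next
    fix i j assume "i \<in> {1..int m}" "j \<in> {1..int m}"
    then show "p i \<perp> p (- j) \<longleftrightarrow> i \<noteq> j" using frame_col[OF fr idx(1) idx(2), of i j] by simp
  next
    fix x y assume "x \<in> X" "y \<in> X"
    then show "x \<perp> y" using singular_col[OF \<open>singular M\<close>] X gen_incl by blast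
  qed (use X in auto)
  then show ?thesis using X by simp
qed

text \<open>
  A point outside the span \<open>M\<close> of the positive half of the frame and collinear with all of \<open>M\<close>
  can be moved, one index at a time along the line to \<open>p i\<close>, to a point also
  collinear with \<open>p (- i)\<close>.
\<close>

lemma rank_le_frame:
  assumes rank: "has_finite_rank P L n" and fr: "polar_frame P L m p"
    and full: "\<nexists>z. z \<in> P \<and> (\<forall>k\<in>frame_index m. z \<perp> p k)"
  shows "n \<le> m"
proof -
  define X where "X = p ` {1..int m}"
  have M: "singular (gen X)" using frame_half_singular[OF fr] unfolding X_def .
  have idx: "i \<in> frame_index m" "- i \<in> frame_index m" if "i \<in> {1..int m}" for i
    using that by (auto simp: frame_index_def)
  have pM: "p i \<in> gen X" if "i \<in> {1..int m}" for i
    using gen_incl that unfolding X_def by blast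
  have "S = gen X" if S: "singular S" "gen X \<subseteq> S" for S
  proof (rule ccontr)
    assume "S \<noteq> gen X"
    then obtain z where z: "z \<in> S" "z \<notin> gen X" using S by blast
    have "\<exists>z\<in>P. z \<notin> gen X \<and> (\<forall>i\<in>{1..int m}. z \<perp> p i) \<and> (\<forall>i\<in>{1..int k}. z \<perp> p (- i))"
      if "k \<le> m" for k using that
    proof (induction k)
      case 0
      have "z \<in> P" using z singular_P S by blast
      moreover have "z \<perp> p i" if "i \<in> {1..int m}" for i using singular_col[OF S(1)] pM[OF that] S z by blast
      ultimately show ?case using z by auto
    next
      case (Suc k)
      then obtain y where y: "y \<in> P" "y \<notin> gen X" "\<And>i. i \<in> {1..int m} \<Longrightarrow> y \<perp> p i"
        "\<And>i. i \<in> {1..int k} \<Longrightarrow> y \<perp> p (- i)" by auto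
      let ?j = "int (Suc k)"
      have j: "?j \<in> {1..int m}" using Suc.prems by simp
      have "y \<noteq> p ?j" using y(2) pM[OF j] by blast
      then obtain l where l: "l \<in> L" "y \<in> l" "p ?j \<in> l" using y(3)[OF j] col_obtain_line by blast
      obtain w where w: "w \<in> l" "p (- ?j) \<perp> w"
        using col_line_ex[OF l(1) frame_in[OF fr idx(2)[OF j]]] .
      have wp: "w \<noteq> p ?j" using w frame_col[OF fr idx(2)[OF j] idx(1)[OF j]] by auto
      have "w \<notin> gen X"
        using subspaceD[OF singular_sub[OF M] l(1) w(1) l(3) _ pM[OF j] wp] l y by blast
      moreover have cw: "w \<perp> q" if "y \<perp> q" "p ?j \<perp> q" for q
        using col_line_all[OF l \<open>y \<noteq> p ?j\<close> _ _ w(1)] that col_sym by blast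
      have "w \<perp> p i" if "i \<in> {1..int m}" for i
        using cw[OF y(3)[OF that]] frame_col[OF fr idx(1)[OF j] idx(1)[OF that]] that by auto
      moreover have "w \<perp> p (- i)" if i: "i \<in> {1..?j}" for i
      proof (cases "i = ?j")
        case False
        then have i': "i \<in> {1..int k}" using i by auto
        then have "i \<in> {1..int m}" using Suc.prems by auto
        then show ?thesis using cw[OF y(4)[OF i']] frame_col[OF fr idx(1)[OF j] idx(2), of i] False by auto
      qed (use w col_sym in blast)
      ultimately show ?case using col_in w by blast
    qed
    from this[OF order_refl]
    obtain y where y: "y \<in> P" "\<And>i. i \<in> {1..int m} \<Longrightarrow> y \<perp> p i \<and> y \<perp> p (- i)" by blast
    have "y \<perp> p i" if "i \<in> frame_index m" for i
      using y(2)[of i] y(2)[of "- i"] that by (cases "i > 0") (auto simp: frame_index_def)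
    then show False using full y by blast
  qed
  then have "maximal_singular P L (gen X)" using M unfolding maximal_singular_def by blast
  moreover have "finite X" "X \<subseteq> P" using frame_in[OF fr] idx unfolding X_def by auto
  ultimately have "n \<le> card X" using rank unfolding has_finite_rank_def min_generators_def by blast
  also have "\<dots> \<le> m" unfolding X_def using card_image_le[of "{1..int m}" p] by simp
  finally show ?thesis .
qed

text \<open>Places configurations of two or three opposite pairs in a full frame. A frame shorter
  than the rank leaves a point \<open>z\<close> collinear with all its members
  (\<open>rank_le_frame\<close>), and \<open>frame_nondegenerate\<close> finds an opposite partner
  for it.\<close>

lemma frame_extend:
  assumes rank: "has_finite_rank P L n"
  shows "polar_frame P L m p \<Longrightarrow> \<exists>q. polar_frame P L n q \<and> (\<forall>i\<in>frame_index m. q i = p i)"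
proof (induction "n - m" arbitrary: m p rule: less_induct)
  case less
  show ?case
  proof (cases "m = n")
    case False
    then have "m < n" using frame_le_rank[OF rank less.prems] by simp
    then obtain z where z: "z \<in> P" "\<forall>k\<in>frame_index m. z \<perp> p k"
      using rank_le_frame[OF rank less.prems] by fastforce
    obtain z' where z': "z' \<in> P" "\<forall>k\<in>frame_index m. z' \<perp> p k" "\<not> z' \<perp> z"
      using frame_nondegenerate[OF polar less.prems z] by blast
    let ?q = "p(int (Suc m) := z, - int (Suc m) := z')"
    have "polar_frame P L (Suc m) ?q"
      using frame_add_pair[OF less.prems z(2) z'(2) z(1) z'(1)] z' col_sym by blast
    moreover have "n - Suc m < n - m" using \<open>m < n\<close> by simp
    ultimately obtain q where q: "polar_frame P L n q" "\<forall>i\<in>frame_index (Suc m). q i = ?q i"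
      using less.hyps[of "Suc m" ?q] by blast
    have "q i = p i" if "i \<in> frame_index m" for i
      using q(2) that by (auto simp: frame_index_def)
    then show ?thesis using q by blast
  qed (use less.prems in blast)
qed

text \<open>\<open>p (- k)\<close> detects \<open>p k\<close>: it is collinear with every other
  frame point, hence with any span of other frame points.\<close>

lemma frame_mem_gen:
  assumes fr: "polar_frame P L m p" and "X \<subseteq> p ` frame_index m" "k \<in> frame_index m" "p k \<in> gen X"
  shows "p k \<in> X"
proof (rule ccontr)
  assume pk: "p k \<notin> X"
  have k: "- k \<in> frame_index m" using assms by simp
  have "p (- k) \<perp> x" if "x \<in> X" for x
  proof -
    obtain j where j: "j \<in> frame_index m" "x = p j" using assms \<open>x \<in> X\<close> by blast
    then have "- k + j \<noteq> 0" using pk that by auto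
    then show ?thesis using frame_col[OF fr k j(1)] j by blast
  qed
  then have "p (- k) \<perp> p k" using gen_sub_perp frame_in[OF fr k] assms(4) by blast
  then show False using frame_col[OF fr k assms(3)] by simp
qed

lemma apartment_iff:
  assumes "p ` frame_index m \<subseteq> P"
  shows "S \<in> frame_apartment P L m p \<longleftrightarrow>
    (\<exists>X\<subseteq>p ` frame_index m. S = gen X \<and> (\<forall>x\<in>X. \<forall>y\<in>X. x \<perp> y))"
  (is "?l \<longleftrightarrow> ?r")
proof
  assume ?l
  then obtain X where X: "X \<subseteq> p ` frame_index m" "S = gen X" "singular S"
    unfolding frame_apartment_def by blast
  then have "\<forall>x\<in>X. \<forall>y\<in>X. x \<perp> y" using singular_col[OF X(3)] gen_incl[of X] by blast
  then show ?r using X by blast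
next
  assume ?r
  then obtain X where X: "X \<subseteq> p ` frame_index m" "S = gen X" "\<forall>x\<in>X. \<forall>y\<in>X. x \<perp> y" by blast
  then have "singular S" using gen_singular[of X] assms by blast
  then show ?l using X unfolding frame_apartment_def by blast
qed

text \<open>Recovers the frame as a set from the apartment, which forgets the indexing. Inclusions
  of roots in apartments thus yield inclusions of sets of frame points.\<close>

lemma apartment_point_iff:
  assumes "p ` frame_index m \<subseteq> P"
  shows "{z} \<in> frame_apartment P L m p \<longleftrightarrow> z \<in> p ` frame_index m"
proof
  assume "{z} \<in> frame_apartment P L m p"
  then obtain X where X: "X \<subseteq> p ` frame_index m" "{z} = gen X" unfolding frame_apartment_def by blast
  then have "X \<noteq> {}" "X \<subseteq> {z}" using gen_empty gen_incl by auto
  then show "z \<in> p ` frame_index m" using X by blast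
next
  assume z: "z \<in> p ` frame_index m"
  then have "z \<in> P" using assms by blast
  then have "{z} = gen {z}" "singular {z}" using gen_single singular_single by auto
  then show "{z} \<in> frame_apartment P L m p" using z unfolding frame_apartment_def by blast
qed

lemma apartment_cong:
  "p ` frame_index m = q ` frame_index m \<Longrightarrow> frame_apartment P L m p = frame_apartment P L m q"
  unfolding frame_apartment_def by simp

lemma apartment_finite: "finite (frame_apartment P L m p)"
  by (rule finite_subset[of _ "generated P L ` Pow (p ` frame_index m)"])
    (auto simp: frame_apartment_def)

text \<open>Opposition without indices, for frames known only as sets of points, such as that of
  another apartment containing a given root.\<close>

lemma frame_opposite_unique:
  assumes fr: "polar_frame P L m p" and z: "z \<in> p ` frame_index m"
  shows "\<exists>w\<in>p ` frame_index m. \<not> z \<perp> w \<and> (\<forall>v\<in>p ` frame_index m. \<not> z \<perp> v \<longrightarrow> v = w)"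
proof -
  obtain k where k: "k \<in> frame_index m" "z = p k" using z by blast
  have "\<not> z \<perp> p (- k)" using frame_col[OF fr k(1), of "- k"] k by simp
  moreover have "p j = p (- k)" if "j \<in> frame_index m" "\<not> z \<perp> p j" for j
    using frame_col[OF fr k(1) that(1)] that k by (metis add_eq_0_iff)
  ultimately show ?thesis using k(1) frame_index_uminus by blast
qed

subsection \<open>Collineations\<close>

context
  fixes g assumes g: "collineation P L g"
begin

lemma collineation_line: "l \<in> L \<Longrightarrow> g ` l \<in> L"
  using g unfolding collineation_def bij_betw_def by blast

lemma collineation_line_ex: "l \<in> L \<Longrightarrow> \<exists>m\<in>L. l = g ` m"
  using g unfolding collineation_def bij_betw_def by (metis imageE)

lemma collineation_inj: "g x = g y \<Longrightarrow> x = y"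
  using g permutes_inj unfolding collineation_def by (metis injD)

lemma collineation_in: "g x \<in> P \<longleftrightarrow> x \<in> P"
  using g permutes_in_image unfolding collineation_def by metis

lemma collineation_col: "g x \<perp> g y \<longleftrightarrow> x \<perp> y"
proof
  assume "x \<perp> y"
  then show "g x \<perp> g y"
    using collineation_in collineation_line unfolding collinear_pts_def by (meson imageI)
next
  assume h: "g x \<perp> g y"
  show "x \<perp> y"
  proof (cases "x = y")
    case False
    then have "g x \<noteq> g y" using collineation_inj by blast
    then obtain l where "l \<in> L" "g x \<in> l" "g y \<in> l" using h col_obtain_line by blast
    then obtain m where "m \<in> L" "g x \<in> g ` m" "g y \<in> g ` m" using collineation_line_ex by metis
    then have "x \<in> m" "y \<in> m" "m \<in> L" using collineation_inj by blast+
    then show ?thesis using col_line by blast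
  qed (use h col_in col_refl collineation_in in blast)
qed

lemma collineation_gen:
  assumes "X \<subseteq> P"
  shows "g ` gen X = gen (g ` X)"
proof
  have gP: "g ` X \<subseteq> P" using assms collineation_in by blast
  have "geom_subspace P L (g -` gen (g ` X))"
  proof (rule subspaceI)
    show "g -` gen (g ` X) \<subseteq> P" using gen_sub_P[OF gP] collineation_in by blast
    fix l x y z
    assume l: "l \<in> L" "x \<in> l" "y \<in> l" "x \<in> g -` gen (g ` X)" "y \<in> g -` gen (g ` X)" "x \<noteq> y" "z \<in> l"
    then have "g ` l \<subseteq> gen (g ` X)"
      using subspaceD[OF gen_subspace[OF gP] collineation_line, of l "g x" "g y"] collineation_inj by blast
    then show "z \<in> g -` gen (g ` X)" using l by blast
  qed
  then have "gen X \<subseteq> g -` gen (g ` X)" using gen_incl[of "g ` X"] by (intro gen_least) auto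
  then show "g ` gen X \<subseteq> gen (g ` X)" by blast
  have "geom_subspace P L (g ` gen X)"
  proof (rule subspaceI)
    show "g ` gen X \<subseteq> P" using gen_sub_P[OF assms] collineation_in by blast
    fix l x y z
    assume l: "l \<in> L" "x \<in> l" "y \<in> l" "x \<in> g ` gen X" "y \<in> g ` gen X" "x \<noteq> y" "z \<in> l"
    obtain m where m: "m \<in> L" "l = g ` m" using collineation_line_ex l by blast
    obtain x' y' where xy: "x = g x'" "y = g y'" "x' \<in> gen X" "y' \<in> gen X" using l by blast
    then have "x' \<in> m" "y' \<in> m" "x' \<noteq> y'" using l m collineation_inj by blast+
    then have "m \<subseteq> gen X" using subspaceD[OF gen_subspace[OF assms] m(1)] xy by blast
    then show "z \<in> g ` gen X" using l m by blast
  qed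
  then show "gen (g ` X) \<subseteq> g ` gen X" by (rule gen_least) (rule image_mono[OF gen_incl])
qed

lemma collineation_frame: "polar_frame P L m p \<Longrightarrow> polar_frame P L m (g \<circ> p)"
  unfolding polar_frame_def o_def
  using collineation_in collineation_col collineation_inj by (simp add: inj_on_def image_subset_iff)

lemma collineation_apartment:
  assumes "p ` frame_index m \<subseteq> P"
  shows "image g ` frame_apartment P L m p = frame_apartment P L m (g \<circ> p)"
proof -
  have gP: "(g \<circ> p) ` frame_index m \<subseteq> P" using assms collineation_in by auto
  have "g ` S \<in> frame_apartment P L m (g \<circ> p)" if S: "S \<in> frame_apartment P L m p" for S
  proof -
    obtain X where X: "X \<subseteq> p ` frame_index m" "S = gen X" "\<forall>x\<in>X. \<forall>y\<in>X. x \<perp> y"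
      using S unfolding apartment_iff[OF assms] by blast
    have "X \<subseteq> P" using X(1) assms by (rule subset_trans)
    then have "g ` S = gen (g ` X)" using collineation_gen X(2) by simp
    moreover have "g ` X \<subseteq> (g \<circ> p) ` frame_index m" using X by auto
    moreover have "\<forall>x\<in>g ` X. \<forall>y\<in>g ` X. x \<perp> y" using X(3) collineation_col by auto
    ultimately show ?thesis unfolding apartment_iff[OF gP] by (intro exI[of _ "g ` X"]) simp
  qed
  moreover have "S \<in> image g ` frame_apartment P L m p" if S: "S \<in> frame_apartment P L m (g \<circ> p)" for S
  proof -
    obtain Y where Y: "Y \<subseteq> (g \<circ> p) ` frame_index m" "S = gen Y" "\<forall>x\<in>Y. \<forall>y\<in>Y. x \<perp> y"
      using S unfolding apartment_iff[OF gP] by blast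
    then obtain X where X: "X \<subseteq> p ` frame_index m" "Y = g ` X"
      by (metis image_comp subset_image_iff)
    then have "X \<subseteq> P" using assms by (blast intro: subset_trans)
    then have "S = g ` gen X" using collineation_gen X(2) Y(2) by simp
    moreover have "\<forall>x\<in>X. \<forall>y\<in>X. x \<perp> y" using Y X collineation_col by blast
    then have "gen X \<in> frame_apartment P L m p" using X unfolding apartment_iff[OF assms] by blast
    ultimately show ?thesis by blast
  qed
  ultimately show ?thesis by blast
qed

end

lemma collineation_comp:
  assumes "collineation P L g" "collineation P L h"
  shows "collineation P L (g \<circ> h)"
proof -
  have "image (g \<circ> h) = image g \<circ> image h" by (simp add: fun_eq_iff image_comp)
  then show ?thesis
    using assms unfolding collineation_def by (metis permutes_compose bij_betw_trans)
qed

subsection \<open>Roots and root elations\<close>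

text \<open>Injectivity comes from opposition: \<open>q a\<close> is the only member not collinear
  with \<open>q (- a)\<close>.\<close>

lemma frameI:
  assumes "\<And>a. a \<in> frame_index m \<Longrightarrow> q a \<in> P" "\<And>a. a \<in> frame_index m \<Longrightarrow> \<not> q a \<perp> q (- a)"
    and "\<And>a b. a \<in> frame_index m \<Longrightarrow> b \<in> frame_index m \<Longrightarrow> a \<noteq> b \<Longrightarrow> a + b \<noteq> 0 \<Longrightarrow> q a \<perp> q b"
  shows "polar_frame P L m q"
proof -
  have c: "q a \<perp> q b \<longleftrightarrow> a + b \<noteq> 0" if "a \<in> frame_index m" "b \<in> frame_index m" for a b
  proof (cases "a + b = 0")
    case True
    then have "b = - a" by simp
    then show ?thesis using assms(2) that by simp
  next
    case False
    then show ?thesis using assms(1,3) col_refl that by (cases "a = b") auto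
  qed
  have "q a \<noteq> q b" if "a \<in> frame_index m" "b \<in> frame_index m" "a \<noteq> b" for a b
    using c[of a "- a"] c[of b "- a"] that by auto
  then show ?thesis unfolding polar_frame_def using c assms(1) by (auto intro: inj_onI)
qed

lemma frame_uminus: "i \<in> frame_index m \<Longrightarrow> polar_frame P L m p \<Longrightarrow> \<not> p i \<perp> p (- i)"
  using frame_col by fastforce

lemma stabilizes_fixed: "fixes_pointwise g S \<Longrightarrow> T \<subseteq> S \<Longrightarrow> stabilizes g T"
  unfolding fixes_pointwise_def stabilizes_def by (auto simp: image_iff subset_iff)

lemma root_elationsD:
  assumes "g \<in> root_elations P L B" "S \<in> B"
  shows "collineation P L g" "u \<in> S \<Longrightarrow> g u = u"
    "singular T \<Longrightarrow> S \<subseteq> T \<Longrightarrow> g ` T = T"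
  using assms unfolding root_elations_def fixes_pointwise_def stabilizes_def by blast+

lemma root_elations_apartment:
  assumes g: "collineation P L g" "\<And>S. S \<in> \<alpha> \<Longrightarrow> g ` S = S"
    and A: "A \<in> apartments P L n" "\<alpha> \<subseteq> A"
  shows "image g ` A \<in> apartments P L n" "\<alpha> \<subseteq> image g ` A"
proof -
  obtain q where q: "A = frame_apartment P L n q" "polar_frame P L n q"
    using A unfolding apartments_def by blast
  then show "image g ` A \<in> apartments P L n"
    using collineation_apartment[OF g(1) frame_sub] collineation_frame[OF g(1)]
    unfolding apartments_def by blast
  show "\<alpha> \<subseteq> image g ` A" using A(2) g(2) by blast
qed

lemma apartment_genD:
  assumes "polar_frame P L n p" "S \<in> frame_apartment P L n p"
  obtains X where "X \<subseteq> p ` frame_index n" "S = gen X" "\<And>x y. x \<in> X \<Longrightarrow> y \<in> X \<Longrightarrow> x \<perp> y"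
    "\<And>k. k \<in> frame_index n \<Longrightarrow> p k \<in> S \<longleftrightarrow> p k \<in> X"
proof -
  obtain X where X: "X \<subseteq> p ` frame_index n" "S = gen X" "\<forall>x\<in>X. \<forall>y\<in>X. x \<perp> y"
    using assms(2) unfolding apartment_iff[OF frame_sub[OF assms(1)]] by blast
  then have "p k \<in> S \<longleftrightarrow> p k \<in> X" if "k \<in> frame_index n" for k
    using frame_mem_gen[OF assms(1) X(1) that] gen_incl[of X] by blast
  then show ?thesis using that X by blast
qed

lemma apartment_genI:
  assumes "polar_frame P L n p" "X \<subseteq> p ` frame_index n" "\<And>x y. x \<in> X \<Longrightarrow> y \<in> X \<Longrightarrow> x \<perp> y"
  shows "gen X \<in> frame_apartment P L n p"
  using assms unfolding apartment_iff[OF frame_sub[OF assms(1)]] by blast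

text \<open>Only \<open>p (- i)\<close> is opposite \<open>p i\<close> in the frame. Spanning sets
  of apartment members can therefore be enlarged by any frame point whose opposite is
  absent.\<close>

lemma insert_opposite_col:
  assumes fr: "polar_frame P L n p" and X: "X \<subseteq> p ` frame_index n" "\<And>x y. x \<in> X \<Longrightarrow> y \<in> X \<Longrightarrow> x \<perp> y"
    and i: "i \<in> frame_index n" "p (- i) \<notin> X"
    and xy: "x \<in> insert (p i) X" "y \<in> insert (p i) X"
  shows "x \<perp> y"
proof -
  have c: "p i \<perp> x" if x: "x \<in> X" for x
  proof -
    obtain k where k: "k \<in> frame_index n" "x = p k" using X x by blast
    then have "i + k \<noteq> 0" using x i by (metis add.commute eq_neg_iff_add_eq_0)
    then show ?thesis using frame_col[OF fr i(1) k(1)] k by blast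
  qed
  have "p i \<perp> p i" using col_refl frame_in[OF fr i(1)] by blast
  then show ?thesis using xy X(2) c col_sym by blast
qed

section \<open>Roots of the first kind\<close>

lemma root1_interior_mem:
  assumes fr: "polar_frame P L n p" and i: "i \<in> frame_index n"
    and k: "k \<in> frame_index n" "k \<noteq> i"
  shows "gen {p (- i), p k} \<in> root1_interior P L n p i"
proof -
  have "gen {p (- i), p k} \<in> frame_apartment P L n p"
  proof (rule apartment_genI[OF fr])
    have "p i \<notin> {p k}" using frame_uminus[OF i fr] frame_col[OF fr k(1), of "- i"] i k by auto
    then show "x \<perp> y" if "x \<in> {p (- i), p k}" "y \<in> {p (- i), p k}" for x y
      using insert_opposite_col[OF fr, of "{p k}" "- i" x y] that i k col_refl frame_in[OF fr k(1)] by simp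
  qed (use i k in auto)
  then show ?thesis using gen_incl[of "{p (- i), p k}"] unfolding root1_interior_def by blast
qed

lemma root1_elation_fixes:
  assumes "polar_frame P L n p" "i \<in> frame_index n" "g \<in> root_elations P L (root1_interior P L n p i)"
    "k \<in> frame_index n" "k \<noteq> i"
  shows "g (p k) = p k"
  using root_elationsD(2)[OF assms(3) root1_interior_mem[OF assms(1,2,4,5)]] gen_incl by blast

text \<open>Root elations are defined by the interior alone, so it takes an argument that they
  preserve the root. A member of the root avoids \<open>p i\<close>, so \<open>p (- i)\<close> can
  be adjoined to its generators; this gives an interior member around it, which is fixed
  pointwise.\<close>

lemma root1_stable:
  assumes fr: "polar_frame P L n p" and i: "i \<in> frame_index n"
    and g: "g \<in> root_elations P L (root1_interior P L n p i)" and S: "S \<in> root1 P L n p i"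
  shows "g ` S = S"
proof -
  have S': "S \<in> frame_apartment P L n p" "p i \<notin> S" using S unfolding root1_def by blast+
  obtain X where X: "X \<subseteq> p ` frame_index n" "S = gen X" "\<And>x y. x \<in> X \<Longrightarrow> y \<in> X \<Longrightarrow> x \<perp> y"
    "\<And>k. k \<in> frame_index n \<Longrightarrow> p k \<in> S \<longleftrightarrow> p k \<in> X"
    using apartment_genD[OF fr S'(1)] by blast
  let ?X = "insert (p (- i)) X"
  have "p (- (- i)) \<notin> X" using X(4)[OF i] S' by simp
  then have "gen ?X \<in> frame_apartment P L n p"
    using insert_opposite_col[OF fr X(1,3), of "- i"] X(1) i by (intro apartment_genI[OF fr]) auto
  then have "gen ?X \<in> root1_interior P L n p i"
    using gen_incl[of ?X] unfolding root1_interior_def by blast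
  moreover have "S \<subseteq> gen ?X" using gen_mono X(2) by blast
  ultimately have "g u = u" if "u \<in> S" for u using root_elationsD(2)[OF g] that by blast
  then show ?thesis by force
qed

text \<open>Members of the root have spanning sets avoiding \<open>p i\<close>, so they survive its
  replacement. With \<open>root1_apartment_frame\<close> as converse, this describes all apartments
  containing the root.\<close>

lemma root1_frame_update:
  assumes fr: "polar_frame P L n p" and i: "i \<in> frame_index n" and y: "y \<in> P" "\<not> y \<perp> p (- i)"
    and c: "\<And>k. k \<in> frame_index n \<Longrightarrow> k \<noteq> i \<Longrightarrow> k \<noteq> - i \<Longrightarrow> y \<perp> p k"
  shows "polar_frame P L n (p(i := y))" "root1 P L n p i \<subseteq> frame_apartment P L n (p(i := y))"
proof -
  have ni: "i \<noteq> - i" using i by (auto simp: frame_index_def)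
  have yi: "\<not> p (- i) \<perp> y" using y col_sym by blast
  have c': "p k \<perp> y" if "k \<in> frame_index n" "k \<noteq> i" "k \<noteq> - i" for k using c[OF that] col_sym by blast
  show F: "polar_frame P L n (p(i := y))"
  proof (rule frameI)
    fix a assume a: "a \<in> frame_index n"
    then show "(p(i := y)) a \<in> P" using y frame_in[OF fr] by simp
    show "\<not> (p(i := y)) a \<perp> (p(i := y)) (- a)"
      using frame_uminus[OF a fr] ni y yi by (cases "a = i"; cases "a = - i") auto
  next
    fix a b assume ab: "a \<in> frame_index n" "b \<in> frame_index n" "a \<noteq> b" "a + b \<noteq> 0"
    have "a \<noteq> - b" "b \<noteq> - a" using ab by auto
    then show "(p(i := y)) a \<perp> (p(i := y)) b"
      using ab c c' frame_col[OF fr ab(1,2)] by (cases "a = i"; cases "b = i") auto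
  qed
  show "root1 P L n p i \<subseteq> frame_apartment P L n (p(i := y))"
  proof
    fix S assume "S \<in> root1 P L n p i"
    then have S': "S \<in> frame_apartment P L n p" "p i \<notin> S" unfolding root1_def by blast+
    obtain X where X: "X \<subseteq> p ` frame_index n" "S = gen X" "\<And>x y. x \<in> X \<Longrightarrow> y \<in> X \<Longrightarrow> x \<perp> y"
      "\<And>k. k \<in> frame_index n \<Longrightarrow> p k \<in> S \<longleftrightarrow> p k \<in> X"
      using apartment_genD[OF fr S'(1)] by blast
    have "X \<subseteq> (p(i := y)) ` frame_index n"
    proof
      fix x assume x: "x \<in> X"
      then obtain k where k: "k \<in> frame_index n" "x = p k" using X by blast
      then have "k \<noteq> i" using x X(4)[OF i] S' by blast
      then show "x \<in> (p(i := y)) ` frame_index n" using k by force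
    qed
    then show "S \<in> frame_apartment P L n (p(i := y))" using apartment_genI[OF F _ X(3)] X(2) by blast
  qed
qed

text \<open>The singletons \<open>{p k}\<close> with \<open>k \<noteq> i\<close> belong to the root,
  so \<open>2 * n - 1\<close> points of the new frame are known; the last one is the opposite of
  \<open>p (- i)\<close> in it.\<close>

lemma root1_apartment_frame:
  assumes fr: "polar_frame P L n p" and i: "i \<in> frame_index n" and q: "polar_frame P L n q"
    and sub: "root1 P L n p i \<subseteq> frame_apartment P L n q"
  obtains y where "q ` frame_index n = insert y (p ` (frame_index n - {i}))" "y \<in> P" "\<not> y \<perp> p (- i)"
    "\<And>k. k \<in> frame_index n \<Longrightarrow> k \<noteq> i \<Longrightarrow> k \<noteq> - i \<Longrightarrow> y \<perp> p k"
proof -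
  let ?I = "frame_index n" and ?F = "p ` (frame_index n - {i})"
  have F: "?F \<subseteq> q ` ?I"
  proof
    fix x assume "x \<in> ?F"
    then obtain k where k: "k \<in> ?I" "k \<noteq> i" "x = p k" by blast
    have "p i \<noteq> p k" using k i fr unfolding polar_frame_def inj_on_def by blast
    then have "{p k} \<in> root1 P L n p i"
      using apartment_point_iff[OF frame_sub[OF fr]] k unfolding root1_def by blast
    then show "x \<in> q ` ?I" using sub apartment_point_iff[OF frame_sub[OF q]] k by blast
  qed
  have cF: "card ?F = 2 * n - 1"
  proof -
    have "inj_on p (?I - {i})" using fr unfolding polar_frame_def by (auto intro: inj_on_subset)
    then show ?thesis using i card_frame_index[of n] by (simp add: card_image)
  qed
  have mi: "- i \<in> ?I" "- i \<noteq> i" using i by (auto simp: frame_index_def)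
  then have "p (- i) \<in> q ` ?I" using F by blast
  from frame_opposite_unique[OF q this]
  obtain y where y: "y \<in> q ` ?I" "\<not> p (- i) \<perp> y" by blast
  have yF: "y \<notin> ?F"
  proof
    assume "y \<in> ?F"
    then obtain k where "k \<in> ?I" "k \<noteq> i" "y = p k" by blast
    then show False using y(2) frame_col[OF fr mi(1), of k] by auto
  qed
  have eq: "insert y ?F = q ` ?I"
  proof (rule card_subset_eq)
    have "n > 0" using i by (cases n) (auto simp: frame_index_def)
    then show "card (insert y ?F) = card (q ` ?I)"
      using yF cF frame_card[OF q] by simp
  qed (use F y in auto)
  have "y \<perp> p k" if k: "k \<in> ?I" "k \<noteq> i" "k \<noteq> - i" for k
  proof (rule ccontr)
    assume "\<not> y \<perp> p k"
    then have n1: "\<not> p k \<perp> y" using col_sym by blast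
    have k2: "- k \<in> ?I" "- k \<noteq> i" using k by auto
    have n2: "\<not> p k \<perp> p (- k)" using frame_uminus[OF k(1) fr] .
    have "p k \<in> q ` ?I" "p (- k) \<in> q ` ?I" using F k k2 by blast+
    then have "y = p (- k)" using frame_opposite_unique[OF q, of "p k"] y(1) n1 n2 by metis
    then show False using yF k2 by blast
  qed
  moreover have "y \<in> P" using y frame_sub[OF q] by blast
  moreover have "\<not> y \<perp> p (- i)" using y col_sym by blast
  ultimately show ?thesis using that eq by metis
qed

text \<open>
  The two hypotheses on \<open>y\<close> and \<open>g y\<close> force \<open>g\<close> to fix
  \<open>gen X\<close> pointwise, since every line through \<open>c\<close> meets \<open>(g y)\<^sup>\<bottom>\<close> in one
  point.  In the planes spanned by \<open>A\<close> and a line through \<open>c\<close>, \<open>g\<close> then fixes two lines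
  pointwise, hence everything.
\<close>

lemma point_elation_fixes_gen:
  assumes g: "collineation P L g" and stab: "\<And>S. singular S \<Longrightarrow> c \<in> S \<Longrightarrow> g ` S = S"
    and A: "A \<in> L" "c \<in> A" "l \<in> A" "l \<noteq> c" "\<And>a. a \<in> A \<Longrightarrow> g a = a"
    and X: "X \<subseteq> P" "\<And>a b. a \<in> X \<Longrightarrow> b \<in> X \<Longrightarrow> a \<perp> b" "l \<in> X" "\<And>a. a \<in> X \<Longrightarrow> c \<perp> a"
    and y: "y \<in> P" "\<not> y \<perp> c" "\<And>a. a \<in> X \<Longrightarrow> y \<perp> a"
    and gy: "\<not> g y \<perp> c" "\<And>a. a \<in> X \<Longrightarrow> g y \<perp> a"
    and u: "u \<in> gen (insert c X)"
  shows "g u = u"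
proof -
  have cP: "c \<in> P" using A line_sub by blast
  have gyP: "g y \<in> P" using collineation_in[OF g] y by blast
  have yX: "y \<perp> s" "g y \<perp> s" if "s \<in> gen X" for s
    using gen_sub_perp[OF y(3) y(1) that] gen_sub_perp[OF gy(2) gyP that] by blast+
  have cX: "c \<notin> gen X" using yX y(2) by blast
  have SX: "singular (gen X)" using gen_singular X by blast
  have ScX: "singular (gen (insert c X))"
    using X cP col_refl[OF cP] col_sym by (intro gen_singular) auto
  have XcX: "gen X \<subseteq> gen (insert c X)" "c \<in> gen (insert c X)"
    using gen_mono[of X "insert c X"] gen_incl[of "insert c X"] by blast+
  have fixX: "g s = s" if s: "s \<in> gen X" for s
  proof (rule ccontr)
    assume ne: "g s \<noteq> s"
    have "c \<perp> s" "c \<noteq> s" using singular_col[OF ScX] XcX s cX by blast+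
    then obtain m where m: "m \<in> L" "c \<in> m" "s \<in> m" using col_obtain_line by blast
    have "g s \<in> m" using stab[OF line_singular[OF m(1)] m(2)] m(3) by blast
    moreover have "g y \<perp> g s" using yX(1)[OF s] collineation_col[OF g] by blast
    ultimately have "g y \<perp> c" using col_line_all[OF m(1) _ m(3) ne _ yX(2)[OF s] m(2)] by blast
    then show False using gy by blast
  qed
  show "g u = u"
  proof (cases "u = c \<or> u \<in> gen X \<or> u \<in> A")
    case True
    then show ?thesis using A fixX by blast
  next
    case False
    then obtain s m where s: "s \<in> gen X" "m \<in> L" "c \<in> m" "s \<in> m" "u \<in> m"
      using gen_insert_cone[OF X(1,2) cP X(4) cX u] by blast
    have sc: "s \<noteq> c" using s cX by blast
    have lX: "l \<in> gen X" using gen_incl X by blast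
    have mA: "A \<noteq> m" using False s by blast
    have ls: "l \<noteq> s" using mA line_unique[of A m c l] A s sc by blast
    obtain w where w: "w \<in> A" "w \<noteq> c" "w \<noteq> l" using third_point[OF A(1)] by metis
    have sub: "A \<subseteq> gen (insert c X)" "m \<subseteq> gen (insert c X)"
      using subspaceD[OF singular_sub[OF ScX]] A s sc XcX lX by blast+
    obtain v m' k where v: "m' \<in> L" "l \<in> m'" "s \<in> m'" "v \<in> m'" "k \<in> L" "w \<in> k" "u \<in> k" "v \<in> k"
    proof (rule veblen[OF A(1-3) w(1) s(2,3,4,5) mA])
      show "a \<perp> b" if "a \<in> A" "b \<in> m" for a b using singular_col[OF ScX] sub that by blast
    qed (use False A w sc in auto)
    have "m' \<subseteq> gen X" using subspaceD[OF singular_sub[OF SX] v(1-3) lX s(1) ls] .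
    then have vX: "v \<in> gen X" "c \<notin> m'" using v cX by blast+
    have "w \<noteq> v" using vX line_unique[of m' A l w] v A w by metis
    moreover have "w \<in> g ` k" "v \<in> g ` k"
      using v A(5)[OF w(1)] fixX[OF vX(1)] by (metis imageI)+
    ultimately have "g ` k = k" using line_unique[OF collineation_line[OF g v(5)] v(5)] v by blast
    then have gk: "g u \<in> k" using v by blast
    have gm: "g u \<in> m" using stab[OF line_singular[OF s(2)] s(3)] s(5) by blast
    show ?thesis
    proof (rule ccontr)
      assume "g u \<noteq> u"
      then have "k = m" using line_unique[of k m u "g u"] gk gm s v by metis
      then show False using line_unique[of A m c w] A w s v mA by blast
    qed
  qed
qed

text \<open>\<open>y\<close> and \<open>g y\<close> are the points replacing \<open>p i\<close> in
  two apartments containing the root; their collinearities are what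
  \<open>point_elation_fixes_gen\<close> asks for.\<close>

lemma point_elation_root1:
  assumes fr: "polar_frame P L n p" and i: "i \<in> frame_index n" and k: "k \<in> frame_index n" "k \<noteq> i" "k \<noteq> - i"
    and K: "K \<in> L" "p (- i) \<in> K" "p k \<in> K" and K': "K' \<in> L" "p (- i) \<in> K'" "p (- k) \<in> K'"
    and g: "g \<in> point_elations P L K (p (- i)) K'"
    and y: "y \<in> P" "\<not> y \<perp> p (- i)" "\<And>k. k \<in> frame_index n \<Longrightarrow> k \<noteq> i \<Longrightarrow> k \<noteq> - i \<Longrightarrow> y \<perp> p k"
    and gy: "\<not> g y \<perp> p (- i)" "\<And>k. k \<in> frame_index n \<Longrightarrow> k \<noteq> i \<Longrightarrow> k \<noteq> - i \<Longrightarrow> g y \<perp> p k"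
  shows "g \<in> root_elations P L (root1_interior P L n p i)"
proof -
  let ?c = "p (- i)"
  have gc: "collineation P L g" and stab: "\<And>S. singular S \<Longrightarrow> ?c \<in> S \<Longrightarrow> g ` S = S"
    and fK: "\<And>a. a \<in> K \<Longrightarrow> g a = a" "\<And>a. a \<in> K' \<Longrightarrow> g a = a"
    using g unfolding point_elations_def stabilizes_def fixes_pointwise_def by blast+
  have fixS: "g u = u" if S: "S \<in> root1_interior P L n p i" and u: "u \<in> S" for S u
  proof -
    have S': "S \<in> frame_apartment P L n p" "?c \<in> S" using S unfolding root1_interior_def by blast+
    obtain X where X: "X \<subseteq> p ` frame_index n" "S = gen X" "\<And>x y. x \<in> X \<Longrightarrow> y \<in> X \<Longrightarrow> x \<perp> y"
      "\<And>k. k \<in> frame_index n \<Longrightarrow> p k \<in> S \<longleftrightarrow> p k \<in> X"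
      using apartment_genD[OF fr S'(1)] by blast
    have cX: "?c \<in> X" using X(4)[of "- i"] i S' by simp
    \<comment> \<open>At most one of \<open>p k\<close>, \<open>p (- k)\<close> is in
      \<open>X\<close>. With the sign chosen so that \<open>p (- j)\<close> is absent,
      \<open>p j\<close> can be adjoined, and with it the line \<open>K\<close> or
      \<open>K'\<close>, which \<open>g\<close> fixes pointwise.\<close>
    define j where "j = (if p (- k) \<in> X then - k else k)"
    have j: "j \<in> frame_index n" "j \<noteq> i" "j \<noteq> - i" "p (- j) \<notin> X"
    proof -
      show "p (- j) \<notin> X" using X(3) frame_uminus[OF k(1) fr] unfolding j_def by auto
    qed (use k in \<open>auto simp: j_def\<close>)
    define X0 where "X0 = insert (p j) X - {?c}"
    have X0: "X0 \<subseteq> p ` frame_index n" using X(1) j unfolding X0_def by blast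
    have X0P: "X0 \<subseteq> P" using X0 frame_sub[OF fr] by blast
    have pw: "a \<perp> b" if "a \<in> insert (p j) X" "b \<in> insert (p j) X" for a b
      using insert_opposite_col[OF fr X(1,3) j(1,4) that] .
    have X0k: "\<exists>k. k \<in> frame_index n \<and> k \<noteq> i \<and> k \<noteq> - i \<and> x = p k" if x: "x \<in> X0" for x
    proof -
      obtain k where "k \<in> frame_index n" "x = p k" using x X0 by blast
      moreover have "?c \<perp> x" "x \<noteq> ?c" using pw x cX unfolding X0_def by auto
      ultimately show ?thesis using frame_uminus[of "- i"] fr i by auto
    qed
    have pjc: "p j \<noteq> ?c" using j i fr unfolding polar_frame_def inj_on_def by (metis frame_index_uminus)
    define A where "A = (if p (- k) \<in> X then K' else K)"
    have A: "A \<in> L" "?c \<in> A" "p j \<in> A" "\<And>a. a \<in> A \<Longrightarrow> g a = a"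
      using K K' fK unfolding A_def j_def by (auto split: if_splits)
    have "X \<subseteq> insert ?c X0" unfolding X0_def by blast
    then have u': "u \<in> gen (insert ?c X0)" using gen_mono u X(2) by blast
    show ?thesis
    proof (rule point_elation_fixes_gen[OF gc stab A(1-3) pjc A(4) X0P _ _ _ y(1,2) _ gy(1) _ u'])
      show "p j \<in> X0" using pjc unfolding X0_def by blast
      show "a \<perp> b" if "a \<in> X0" "b \<in> X0" for a b using pw that unfolding X0_def by blast
      show "?c \<perp> a" if "a \<in> X0" for a using pw cX that unfolding X0_def by blast
      show "y \<perp> a" if "a \<in> X0" for a using X0k[OF that] y(3) by blast
      show "g y \<perp> a" if "a \<in> X0" for a using X0k[OF that] gy(2) by blast
    qed
  qed
  have "stabilizes g T" if "singular T" "S \<in> root1_interior P L n p i" "S \<subseteq> T \<or> T \<subseteq> S" for S T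
    using that(3)
  proof
    assume "S \<subseteq> T"
    then have "?c \<in> T" using that unfolding root1_interior_def by blast
    then show ?thesis using stab that unfolding stabilizes_def by blast
  next
    assume "T \<subseteq> S"
    moreover have "fixes_pointwise g S" using fixS[OF that(2)] unfolding fixes_pointwise_def by blast
    ultimately show ?thesis using stabilizes_fixed by blast
  qed
  then show ?thesis using gc fixS unfolding root_elations_def fixes_pointwise_def by blast
qed

lemma line_elationsD:
  assumes "g \<in> line_elations P L p M q"
  shows "collineation P L g" "u \<in> M \<Longrightarrow> g u = u" "singular S \<Longrightarrow> p \<in> S \<Longrightarrow> g ` S = S"
    "singular S \<Longrightarrow> q \<in> S \<Longrightarrow> g ` S = S"
  using assms unfolding line_elations_def fixes_pointwise_def stabilizes_def by blast+

lemma point_elationsD: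
  assumes "g \<in> point_elations P L K c K'"
  shows "collineation P L g" "u \<in> K \<Longrightarrow> g u = u" "u \<in> K' \<Longrightarrow> g u = u"
    "singular S \<Longrightarrow> c \<in> S \<Longrightarrow> g ` S = S"
  using assms unfolding point_elations_def fixes_pointwise_def stabilizes_def by blast+

lemma line_elation_fixes_perp:
  assumes g: "g \<in> line_elations P L p M q" and M: "M \<in> L" "p \<in> M" "q \<in> M" "p \<noteq> q"
    and u: "u \<perp> p" "u \<perp> q"
  shows "g u = u"
proof (cases "u \<in> M")
  case False
  then have "u \<noteq> p" "u \<noteq> q" using M by blast+
  obtain k where k: "k \<in> L" "u \<in> k" "p \<in> k" using u(1) \<open>u \<noteq> p\<close> col_obtain_line by blast
  obtain m where m: "m \<in> L" "u \<in> m" "q \<in> m" using u(2) \<open>u \<noteq> q\<close> col_obtain_line by blast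
  have "g u \<in> k" "g u \<in> m"
    using line_elationsD(3,4)[OF g line_singular] k m by blast+
  moreover have "k \<noteq> m" using line_unique[of k M p q] k m M False by blast
  ultimately show ?thesis using line_unique[of k m u "g u"] k m by metis
qed (use line_elationsD(2)[OF g] in blast)

lemma root1_transitive:
  assumes M1: "property_M1 P L" and n: "n \<ge> 2"
    and fr: "polar_frame P L n p" and i: "i \<in> frame_index n"
    and A: "A \<in> apartments P L n" "root1 P L n p i \<subseteq> A"
    and B: "B \<in> apartments P L n" "root1 P L n p i \<subseteq> B"
  shows "\<exists>g\<in>root_elations P L (root1_interior P L n p i). image g ` A = B"
proof -
  let ?I = "frame_index n" and ?c = "p (- i)"
  obtain q1 where q1: "A = frame_apartment P L n q1" "polar_frame P L n q1"
    using A(1) unfolding apartments_def by blast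
  obtain q2 where q2: "B = frame_apartment P L n q2" "polar_frame P L n q2"
    using B(1) unfolding apartments_def by blast
  obtain y1 where y1: "q1 ` ?I = insert y1 (p ` (?I - {i}))" "y1 \<in> P" "\<not> y1 \<perp> ?c"
    "\<And>k. k \<in> ?I \<Longrightarrow> k \<noteq> i \<Longrightarrow> k \<noteq> - i \<Longrightarrow> y1 \<perp> p k"
    using root1_apartment_frame[OF fr i q1(2)] A(2) q1(1) by metis
  obtain y2 where y2: "q2 ` ?I = insert y2 (p ` (?I - {i}))" "y2 \<in> P" "\<not> y2 \<perp> ?c"
    "\<And>k. k \<in> ?I \<Longrightarrow> k \<noteq> i \<Longrightarrow> k \<noteq> - i \<Longrightarrow> y2 \<perp> p k"
    using root1_apartment_frame[OF fr i q2(2)] B(2) q2(1) by metis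
  \<comment> \<open>Any index other than \<open>i\<close> and \<open>- i\<close> would do; it exists
    because \<open>n \<ge> 2\<close>. The opposite points \<open>p k\<close>, \<open>p (- k)\<close>
    serve as \<open>x\<close>, \<open>x'\<close> in (M1), so the lines joining them to
    \<open>p (- i)\<close> are not coplanar.\<close>
  define k :: int where "k = (if \<bar>i\<bar> = 1 then 2 else 1)"
  have k: "k \<in> ?I" "k \<noteq> i" "k \<noteq> - i" using n i unfolding k_def frame_index_def by auto
  have mk: "- k \<in> ?I" "- k \<noteq> i" "- k \<noteq> - i" using k by auto
  have mi: "- i \<in> ?I" using i by simp
  have inj: "p a \<noteq> p b" if "a \<in> ?I" "b \<in> ?I" "a \<noteq> b" for a b
    using fr that unfolding polar_frame_def inj_on_def by blast
  have ck: "?c \<perp> p k" "?c \<perp> p (- k)" using frame_col[OF fr mi] k mk by auto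
  obtain K where K: "K \<in> L" "?c \<in> K" "p k \<in> K" using ck(1) inj[OF mi k(1)] k col_obtain_line by metis
  obtain K' where K': "K' \<in> L" "?c \<in> K'" "p (- k) \<in> K'"
    using ck(2) inj[OF mi mk(1)] mk col_obtain_line by metis
  have kk: "\<not> p k \<perp> p (- k)" using frame_uminus[OF k(1) fr] .
  then have "K \<noteq> K'" using col_line K K' by blast
  moreover have "\<not> coplanar_lines P L K K'"
    using kk K K' singular_col unfolding coplanar_lines_def sing_plane_def by blast
  moreover have "p k \<in> K - {?c}" "p (- k) \<in> K' - {?c}" using K K' inj mi k mk by auto
  define Y where "Y = {y \<in> perp P L (p k) \<inter> perp P L (p (- k)). opposite_pts P L ?c y}"
  have "acts_transitively (\<lambda>g y. g y) (point_elations P L K ?c K') Y"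
    using M1[unfolded property_M1_def, rule_format, of ?c K K' "p k" "p (- k)"]
      calculation K K' frame_in[OF fr mi] inj[OF k(1) mi k(3)] inj[OF mk(1) mi mk(3)] unfolding Y_def by simp
  moreover have Y: "y \<in> Y"
    if "y \<in> P" "\<not> y \<perp> ?c" "\<And>k. k \<in> ?I \<Longrightarrow> k \<noteq> i \<Longrightarrow> k \<noteq> - i \<Longrightarrow> y \<perp> p k" for y
    using that(1,2) that(3)[OF k] that(3)[OF mk] frame_in[OF fr mi] col_sym
    unfolding Y_def perp_def opposite_pts_def by blast
  have "y1 \<in> Y" by (rule Y[OF y1(2-4)])
  moreover have "y2 \<in> Y" by (rule Y[OF y2(2-4)])
  ultimately obtain g where g: "g \<in> point_elations P L K ?c K'" "g y1 = y2"
    unfolding acts_transitively_def by blast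
  have gr: "g \<in> root_elations P L (root1_interior P L n p i)"
    by (rule point_elation_root1[OF fr i k K K' g(1) y1(2-4)]) (use g(2) y2 in auto)
  have "(g \<circ> q1) ` ?I = g ` (q1 ` ?I)" by (rule image_comp[symmetric])
  also have "\<dots> = insert y2 (g ` p ` (?I - {i}))" using y1(1) g(2) by simp
  also have "g ` p ` (?I - {i}) = p ` (?I - {i})"
    using root1_elation_fixes[OF fr i gr] by (force simp: image_image)
  finally have "(g \<circ> q1) ` ?I = q2 ` ?I" using y2(1) by simp
  moreover have "image g ` A = frame_apartment P L n (g \<circ> q1)"
    using collineation_apartment[OF point_elationsD(1)[OF g(1)] frame_sub[OF q1(2)]] q1(1) by simp
  ultimately show ?thesis using gr apartment_cong q2(1) by metis
qed

section \<open>Roots of the second kind\<close>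

lemma root2_sym: "root2 P L n p i j = root2 P L n p j i"
  unfolding root2_def by blast

lemma root2_interior_sym: "root2_interior P L n p i j = root2_interior P L n p j i"
  unfolding root2_interior_def by blast

text \<open>If \<open>p (- j)\<close> were absent, \<open>p j\<close> could be adjoined, and a
  maximal member above the enlarged span would contain both \<open>p i\<close> and
  \<open>p j\<close>, so \<open>gen X\<close> would have been removed from the root.\<close>

lemma root2_memD:
  assumes fr: "polar_frame P L n p" and i: "i \<in> frame_index n" and j: "j \<in> frame_index n"
    and S: "gen X \<in> root2 P L n p i j" "p i \<in> X"
    and X: "X \<subseteq> p ` frame_index n" "\<And>x y. x \<in> X \<Longrightarrow> y \<in> X \<Longrightarrow> x \<perp> y"
  shows "p (- j) \<in> X"
proof (rule ccontr)
  assume h: "p (- j) \<notin> X"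
  let ?A = "frame_apartment P L n p" and ?X = "insert (p j) X"
  have "gen ?X \<in> ?A"
    using insert_opposite_col[OF fr X j h] X(1) j by (intro apartment_genI[OF fr]) auto
  then obtain M where M: "M \<in> ?A" "gen ?X \<subseteq> M" "\<forall>S\<in>?A. M \<subseteq> S \<longrightarrow> M = S"
    using finite_has_maximal2[OF apartment_finite] by metis
  then have "maximal_member ?A M" unfolding maximal_member_def by metis
  moreover have "gen X \<subseteq> M" "p i \<in> M" "p j \<in> M"
    using M(2) gen_mono[of X ?X] gen_incl[of ?X] S(2) by blast+
  moreover have "p i \<in> gen X" using gen_incl S(2) by blast
  ultimately show False using S(1) unfolding root2_def by blast
qed

context
  fixes p n i j
  assumes fr: "polar_frame P L n p" and i: "i \<in> frame_index n" and j: "j \<in> frame_index n"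
    and ij: "i \<noteq> j" "i + j \<noteq> 0"
begin

lemma root2_point:
  assumes "k \<in> frame_index n" "k \<noteq> i" "k \<noteq> j"
  shows "{p k} \<in> root2 P L n p i j"
proof -
  have "p i \<noteq> p k" "p j \<noteq> p k"
    using assms fr i j unfolding polar_frame_def inj_on_def by blast+
  then show ?thesis
    using apartment_point_iff[OF frame_sub[OF fr]] assms(1) unfolding root2_def by blast
qed

text \<open>No member of the apartment contains both \<open>p j\<close> and this line, since
  \<open>p (- j)\<close> is on it. Such lines are what an apartment containing the root retains of
  the removed points.\<close>

lemma root2_line:
  assumes l: "l \<in> L" "p i \<in> l" "p (- j) \<in> l"
  shows "l \<in> root2 P L n p i j"
proof -
  have mj: "- j \<in> frame_index n" using j by simp
  have ne: "p i \<noteq> p (- j)"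
    using fr i mj ij unfolding polar_frame_def inj_on_def by (metis add.left_inverse)
  have "gen {p i, p (- j)} \<in> frame_apartment P L n p"
    by (rule apartment_genI[OF fr]) (use i j col_line[OF l(1)] l in auto)
  then have "l \<in> frame_apartment P L n p" using gen_pair[OF l ne] by simp
  moreover have False if "maximal_member (frame_apartment P L n p) M" "p j \<in> M" "l \<subseteq> M" for M
  proof -
    have "singular M" using that unfolding maximal_member_def frame_apartment_def by blast
    then show False using singular_col that(2,3) l frame_uminus[OF j fr] by blast
  qed
  ultimately show ?thesis unfolding root2_def by blast
qed

lemma root2_interior_gen:
  assumes "X \<subseteq> p ` frame_index n" "\<And>x y. x \<in> X \<Longrightarrow> y \<in> X \<Longrightarrow> x \<perp> y"
    and "p (- i) \<in> X \<or> p (- j) \<in> X" "p i \<notin> X" "p j \<notin> X"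
  shows "gen X \<in> root2_interior P L n p i j"
  using apartment_genI[OF fr assms(1,2)] frame_mem_gen[OF fr assms(1)] i j assms(3-5) gen_incl[of X]
  unfolding root2_interior_def by blast

lemma root2_interior_pair:
  assumes "k \<in> frame_index n" "k \<noteq> i" "k \<noteq> j"
  shows "gen {p (- i), p k} \<in> root2_interior P L n p i j"
proof (rule root2_interior_gen)
  have inj: "p a \<noteq> p b" if "a \<in> frame_index n" "b \<in> frame_index n" "a \<noteq> b" for a b
    using fr that unfolding polar_frame_def inj_on_def by blast
  have mi: "- i \<in> frame_index n" using i by simp
  have "i \<noteq> - i" "j \<noteq> - i" using i ij by (auto simp: frame_index_def)
  then show "p i \<notin> {p (- i), p k}" "p j \<notin> {p (- i), p k}"
    using inj[OF i mi] inj[OF j mi] inj[OF i assms(1)] inj[OF j assms(1)] assms by auto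
  have "p (- i) \<perp> p k" using frame_col[OF fr mi assms(1)] assms by simp
  then show "x \<perp> y" if "x \<in> {p (- i), p k}" "y \<in> {p (- i), p k}" for x y
    using that frame_in[OF fr] mi assms(1) col_refl col_sym by auto
qed (use i assms in auto)

lemma root2_elation_fixes:
  assumes "g \<in> root_elations P L (root2_interior P L n p i j)"
    and "k \<in> frame_index n" "k \<noteq> i" "k \<noteq> j"
  shows "g (p k) = p k"
  using root_elationsD(2)[OF assms(1) root2_interior_pair[OF assms(2-4)]] gen_incl by blast

text \<open>The interior is a union of subsets of \<open>{p (- i), p (- j)}\<^sup>\<bottom>\<close>.\<close>

lemma line_elation_root2:
  assumes M: "M \<in> L" "p (- i) \<in> M" "p (- j) \<in> M"
    and g: "g \<in> line_elations P L (p (- i)) M (p (- j))"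
  shows "g \<in> root_elations P L (root2_interior P L n p i j)"
proof -
  have m: "- i \<in> frame_index n" "- j \<in> frame_index n" using i j by simp_all
  have "- i \<noteq> - j" using ij by simp
  then have ne: "p (- i) \<noteq> p (- j)" using fr m unfolding polar_frame_def inj_on_def by blast
  have fixS: "g u = u" if S: "S \<in> root2_interior P L n p i j" and u: "u \<in> S" for S u
  proof -
    have S': "S \<in> frame_apartment P L n p" "p i \<notin> S" "p j \<notin> S"
      using S unfolding root2_interior_def by blast+
    obtain X where X: "X \<subseteq> p ` frame_index n" "S = gen X" "\<And>x y. x \<in> X \<Longrightarrow> y \<in> X \<Longrightarrow> x \<perp> y"
      "\<And>k. k \<in> frame_index n \<Longrightarrow> p k \<in> S \<longleftrightarrow> p k \<in> X"
      using apartment_genD[OF fr S'(1)] by blast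
    have "p (- i) \<perp> x" "p (- j) \<perp> x" if "x \<in> X" for x
    proof -
      obtain k where k: "k \<in> frame_index n" "x = p k" using X(1) \<open>x \<in> X\<close> by blast
      then have "k \<noteq> i" "k \<noteq> j" using \<open>x \<in> X\<close> S' X(4) i j by blast+
      then show "p (- i) \<perp> x" "p (- j) \<perp> x" using frame_col[OF fr] m k by auto
    qed
    then have "p (- i) \<perp> u" "p (- j) \<perp> u"
      using gen_sub_perp frame_in[OF fr] m u X(2) by blast+
    then show ?thesis using line_elation_fixes_perp[OF g M ne] col_sym by blast
  qed
  have "stabilizes g T" if "singular T" "S \<in> root2_interior P L n p i j" "S \<subseteq> T \<or> T \<subseteq> S" for S T
    using that(3)
  proof
    assume "S \<subseteq> T"
    then have "p (- i) \<in> T \<or> p (- j) \<in> T" using that unfolding root2_interior_def by blast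
    then show ?thesis using line_elationsD(3,4)[OF g that(1)] unfolding stabilizes_def by blast
  next
    assume "T \<subseteq> S"
    moreover have "fixes_pointwise g S" using fixS[OF that(2)] unfolding fixes_pointwise_def by blast
    ultimately show ?thesis using stabilizes_fixed by blast
  qed
  then show ?thesis
    using line_elationsD(1)[OF g] fixS unfolding root_elations_def fixes_pointwise_def by blast
qed

text \<open>The line \<open>l\<close> belongs to the root, hence is spanned by points of the new
  frame, and one of these is not \<open>p (- j)\<close>. As \<open>p (- j)\<close> is collinear with
  \<open>p (- i)\<close> and \<open>p i\<close> is not, no other point of \<open>l\<close> is
  collinear with \<open>p (- i)\<close>.\<close>

lemma root2_apartment_point:
  assumes q: "polar_frame P L n q" and sub: "root2 P L n p i j \<subseteq> frame_apartment P L n q"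
    and l: "l \<in> L" "p i \<in> l" "p (- j) \<in> l"
  obtains s where "s \<in> q ` frame_index n" "s \<in> l" "\<not> s \<perp> p (- i)"
proof -
  have m: "- i \<in> frame_index n" "- j \<in> frame_index n" using i j by simp_all
  have ne: "p i \<noteq> p (- j)"
    using frame_uminus[OF j fr] frame_col[OF fr i j] ij col_sym by metis
  obtain X where X: "X \<subseteq> q ` frame_index n" "l = gen X"
    using root2_line[OF l] sub unfolding frame_apartment_def by blast
  have "\<not> X \<subseteq> {p (- j)}"
  proof
    assume "X \<subseteq> {p (- j)}"
    then have "gen X \<subseteq> {p (- j)}" using gen_mono gen_single[OF frame_in[OF fr m(2)]] by metis
    then show False using X l ne by blast
  qed
  then obtain s where s: "s \<in> X" "s \<noteq> p (- j)" by blast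
  then have sl: "s \<in> l" using gen_incl X by blast
  have "p (- i) \<perp> p (- j)" using frame_col[OF fr m] ij by simp
  then have "\<not> p (- i) \<perp> s"
    using col_line_all[OF l(1) sl l(3) s(2) _ _ l(2)] frame_uminus[OF i fr] col_sym by blast
  then show ?thesis using that s sl X col_sym by blast
qed

end

text \<open>Here \<open>2 * n - 2\<close> points of the new frame come from singletons of the root,
  and the other two are found on \<open>l\<close> and \<open>k\<close>. \<open>r \<perp> s\<close>
  holds because the opposite of \<open>r\<close> in the new frame is already
  \<open>p (- j)\<close>.\<close>

lemma root2_apartment_frame:
  assumes fr: "polar_frame P L n p" and i: "i \<in> frame_index n" and j: "j \<in> frame_index n"
    and ij: "i \<noteq> j" "i + j \<noteq> 0"
    and q: "polar_frame P L n q" and sub: "root2 P L n p i j \<subseteq> frame_apartment P L n q"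
    and l: "l \<in> L" "p i \<in> l" "p (- j) \<in> l" and k: "k \<in> L" "p j \<in> k" "p (- i) \<in> k"
  obtains s r where "q ` frame_index n = insert s (insert r (p ` (frame_index n - {i, j})))"
    "s \<in> l" "\<not> s \<perp> p (- i)" "r \<in> k" "\<not> r \<perp> p (- j)" "r \<perp> s"
proof -
  let ?I = "frame_index n" and ?F = "p ` (frame_index n - {i, j})"
  have ji: "j \<noteq> i" "j + i \<noteq> 0" using ij by auto
  have m: "- i \<in> ?I" "- j \<in> ?I" "- j \<noteq> i" "- j \<noteq> j" using i j ij by (auto simp: frame_index_def)
  obtain s where s: "s \<in> q ` ?I" "s \<in> l" "\<not> s \<perp> p (- i)"
    using root2_apartment_point[OF fr i j ij q sub l] .
  obtain r where r: "r \<in> q ` ?I" "r \<in> k" "\<not> r \<perp> p (- j)"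
    using root2_apartment_point[OF fr j i ji q sub[unfolded root2_sym[of _ _ i j]] k] .
  have F: "?F \<subseteq> q ` ?I"
  proof
    fix x assume "x \<in> ?F"
    then obtain a where a: "a \<in> ?I" "a \<noteq> i" "a \<noteq> j" "x = p a" by blast
    then show "x \<in> q ` ?I"
      using root2_point[OF fr i j ij a(1-3)] sub apartment_point_iff[OF frame_sub[OF q]] by blast
  qed
  have rs: "r \<noteq> s" using s r col_line[OF k(1) r(2) k(3)] by blast
  have "x \<perp> p (- i)" "x \<perp> p (- j)" if "x \<in> ?F" for x
    using that frame_col[OF fr _ m(1)] frame_col[OF fr _ m(2)] by auto
  then have nF: "s \<notin> ?F" "r \<notin> ?F" using s r by blast+
  have "card ?F = 2 * n - 2"
  proof -
    have "inj_on p (?I - {i, j})" using fr unfolding polar_frame_def by (auto intro: inj_on_subset)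
    then show ?thesis using i j ij card_frame_index[of n] by (simp add: card_image card_Diff_subset)
  qed
  moreover have "n \<ge> 2" using i j ij by (auto simp: frame_index_def)
  ultimately have "card (insert s (insert r ?F)) = card (q ` ?I)"
    using nF rs frame_card[OF q] by simp
  then have eq: "insert s (insert r ?F) = q ` ?I"
    using F s r by (intro card_subset_eq) auto
  have "r \<perp> s"
  proof (rule ccontr)
    assume "\<not> r \<perp> s"
    moreover have "p (- j) \<in> q ` ?I" using F m by blast
    ultimately have "s = p (- j)" using frame_opposite_unique[OF q r(1)] r(3) s(1) by metis
    then show False using s frame_col[OF fr m(2,1)] ij by simp
  qed
  then show ?thesis using that eq s r by metis
qed

text \<open>\<open>p i\<close> may move, so \<open>gen X\<close> need not be fixed pointwise. But
  \<open>X\<close> contains \<open>p (- j)\<close>, so dropping \<open>p i\<close> leaves an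
  interior member inside \<open>gen X\<close>, and singular subspaces around interior members are
  stabilized.\<close>

lemma root2_stable_aux:
  assumes fr: "polar_frame P L n p" and i: "i \<in> frame_index n" and j: "j \<in> frame_index n"
    and ij: "i \<noteq> j" "i + j \<noteq> 0"
    and g: "g \<in> root_elations P L (root2_interior P L n p i j)"
    and S: "gen X \<in> root2 P L n p i j" "p i \<in> X"
    and X: "X \<subseteq> p ` frame_index n" "\<And>x y. x \<in> X \<Longrightarrow> y \<in> X \<Longrightarrow> x \<perp> y"
  shows "g ` gen X = gen X"
proof -
  have mj: "p (- j) \<in> X" using root2_memD[OF fr i j S X] .
  then have "p j \<notin> X" using X(2) frame_uminus[OF j fr] by blast
  moreover have "p (- j) \<noteq> p i"
    using frame_uminus[OF j fr] frame_col[OF fr j i] ij by (metis add.commute)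
  ultimately have "gen (X - {p i}) \<in> root2_interior P L n p i j"
    using X mj by (intro root2_interior_gen[OF fr i j ij]) auto
  moreover have "gen (X - {p i}) \<subseteq> gen X" by (rule gen_mono) blast
  moreover have "singular (gen X)" using S unfolding root2_def frame_apartment_def by blast
  ultimately show ?thesis using root_elationsD(3)[OF g] by blast
qed

lemma root2_stable:
  assumes fr: "polar_frame P L n p" and i: "i \<in> frame_index n" and j: "j \<in> frame_index n"
    and ij: "i \<noteq> j" "i + j \<noteq> 0"
    and g: "g \<in> root_elations P L (root2_interior P L n p i j)" and S: "S \<in> root2 P L n p i j"
  shows "g ` S = S"
proof -
  have "S \<in> frame_apartment P L n p" using S unfolding root2_def by blast
  then obtain X where X: "X \<subseteq> p ` frame_index n" "S = gen X" "\<And>x y. x \<in> X \<Longrightarrow> y \<in> X \<Longrightarrow> x \<perp> y"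
    using apartment_genD[OF fr] by metis
  have ji: "j \<noteq> i" "j + i \<noteq> 0" using ij by auto
  consider "p i \<in> X" | "p j \<in> X" | "p i \<notin> X" "p j \<notin> X" by blast
  then show ?thesis
  proof cases
    case 1
    then show ?thesis using root2_stable_aux[OF fr i j ij g _ _ X(1,3)] S X(2) by blast
  next
    case 2
    then show ?thesis
      using root2_stable_aux[OF fr j i ji _ _ _ X(1,3), of g] g S X(2)
      unfolding root2_sym[of _ _ i j] root2_interior_sym[of _ _ i j] by blast
  next
    case 3
    \<comment> \<open>As for the first kind, adjoining \<open>p (- i)\<close> gives an interior
      member around \<open>S\<close>, which is fixed pointwise.\<close>
    let ?X = "insert (p (- i)) X"
    have mi: "- i \<in> frame_index n" "p (- (- i)) \<notin> X" using 3 i by simp_all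
    have ne: "p (- i) \<noteq> p i" "p (- i) \<noteq> p j"
      using frame_uminus[OF i fr] frame_col[OF fr i j] ij frame_in[OF fr i] col_refl by metis+
    have "gen ?X \<in> root2_interior P L n p i j"
      using insert_opposite_col[OF fr X(1,3) mi] X(1) mi(1) 3 ne
      by (intro root2_interior_gen[OF fr i j ij]) auto
    moreover have "S \<subseteq> gen ?X" using gen_mono X(2) by blast
    ultimately have "g u = u" if "u \<in> S" for u using root_elationsD(2)[OF g] that by blast
    then show ?thesis by force
  qed
qed

lemma root2_transitive:
  assumes M2: "property_M2 P L"
    and fr: "polar_frame P L n p" and i: "i \<in> frame_index n" and j: "j \<in> frame_index n"
    and ij: "i \<noteq> j" "i + j \<noteq> 0"
    and A: "A \<in> apartments P L n" "root2 P L n p i j \<subseteq> A"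
    and B: "B \<in> apartments P L n" "root2 P L n p i j \<subseteq> B"
  shows "\<exists>g\<in>root_elations P L (root2_interior P L n p i j). image g ` A = B"
proof -
  let ?I = "frame_index n"
  have m: "- i \<in> ?I" "- j \<in> ?I" using i j by auto
  have inj: "p a \<noteq> p b" if "a \<in> ?I" "b \<in> ?I" "a \<noteq> b" for a b
    using fr that unfolding polar_frame_def inj_on_def by blast
  have col: "p i \<perp> p (- j)" "p j \<perp> p (- i)" "p (- i) \<perp> p (- j)"
    using frame_col[OF fr] i j m ij by auto
  obtain l where l: "l \<in> L" "p i \<in> l" "p (- j) \<in> l"
    using col(1) inj[OF i m(2)] ij col_obtain_line by (metis add.left_inverse)
  obtain k where k: "k \<in> L" "p j \<in> k" "p (- i) \<in> k"
    using col(2) inj[OF j m(1)] ij col_obtain_line by (metis add.right_inverse)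
  obtain M where M: "M \<in> L" "p (- i) \<in> M" "p (- j) \<in> M"
    using col(3) inj[OF m] ij col_obtain_line by (metis neg_equal_iff_equal)
  obtain q1 where q1: "A = frame_apartment P L n q1" "polar_frame P L n q1"
    using A(1) unfolding apartments_def by blast
  obtain q2 where q2: "B = frame_apartment P L n q2" "polar_frame P L n q2"
    using B(1) unfolding apartments_def by blast
  obtain s1 r1 where 1: "q1 ` ?I = insert s1 (insert r1 (p ` (?I - {i, j})))"
    "s1 \<in> l" "\<not> s1 \<perp> p (- i)" "r1 \<in> k" "\<not> r1 \<perp> p (- j)" "r1 \<perp> s1"
    using root2_apartment_frame[OF fr i j ij q1(2) _ l k] A(2) q1(1) by metis
  obtain s2 r2 where 2: "q2 ` ?I = insert s2 (insert r2 (p ` (?I - {i, j})))"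
    "s2 \<in> l" "\<not> s2 \<perp> p (- i)" "r2 \<in> k" "\<not> r2 \<perp> p (- j)" "r2 \<perp> s2"
    using root2_apartment_frame[OF fr i j ij q2(2) _ l k] B(2) q2(1) by metis
  have jj: "\<not> p j \<perp> p (- j)" using frame_uminus[OF j fr] .
  have "k \<noteq> M" using col_line k M jj by blast
  moreover have "\<not> coplanar_lines P L k M"
    using jj k M singular_col unfolding coplanar_lines_def sing_plane_def by blast
  moreover have ne: "p (- i) \<noteq> p (- j)" using inj[OF m] ij by simp
  ultimately have "acts_transitively (\<lambda>g y. g y) (line_elations P L (p (- i)) M (p (- j))) (k - {p (- i)})"
    using M2 M k unfolding property_M2_def by blast
  moreover have "r1 \<in> k - {p (- i)}" "r2 \<in> k - {p (- i)}" using 1 2 col(3) by auto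
  ultimately obtain g where g: "g \<in> line_elations P L (p (- i)) M (p (- j))" "g r1 = r2"
    unfolding acts_transitively_def by blast
  have gr: "g \<in> root_elations P L (root2_interior P L n p i j)"
    using line_elation_root2[OF fr i j ij M g(1)] .
  \<comment> \<open>(M2) only controls \<open>r1\<close>. The image of \<open>s1\<close> follows,
    since \<open>r2\<close>, being opposite \<open>p (- j)\<close>, is collinear with just one point
    of \<open>l\<close>, and both \<open>g s1\<close> and \<open>s2\<close> are such points.\<close>
  have "g s1 = s2"
  proof (rule ccontr)
    assume ne: "g s1 \<noteq> s2"
    have "g s1 \<in> l" using line_elationsD(4)[OF g(1) line_singular[OF l(1)] l(3)] 1 by blast
    moreover have "r2 \<perp> g s1"
      using collineation_col[OF line_elationsD(1)[OF g(1)], of r1 s1] 1 g(2) by simp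
    ultimately have "r2 \<perp> p (- j)" using col_line_all[OF l(1) _ 2(2) ne _ 2(6) l(3)] by blast
    then show False using 2 by blast
  qed
  moreover have "g ` p ` (?I - {i, j}) = p ` (?I - {i, j})"
    using root2_elation_fixes[OF fr i j ij gr] by (force simp: image_image)
  ultimately have "g ` (q1 ` ?I) = q2 ` ?I" using 1(1) 2(1) g(2) by simp
  then have "(g \<circ> q1) ` ?I = q2 ` ?I" by (simp add: image_comp)
  moreover have "image g ` A = frame_apartment P L n (g \<circ> q1)"
    using collineation_apartment[OF line_elationsD(1)[OF g(1)] frame_sub[OF q1(2)]] q1(1) by simp
  ultimately show ?thesis using gr apartment_cong q2(1) by metis
qed

lemma frame_col_distinct:
  assumes fr: "polar_frame P L n p" and i: "i \<in> frame_index n" and j: "j \<in> frame_index n"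
    and c: "p i \<noteq> p j" "p i \<perp> p j"
  shows "i \<noteq> j" "i + j \<noteq> 0"
  using frame_col[OF fr i j] c by auto

lemma M1_M2_imp_moufang:
  assumes "property_M1 P L" "property_M2 P L" and n: "n \<ge> 2"
  shows "moufang P L n"
proof -
  have "acts_transitively (\<lambda>g A. image g ` A) (root_elations P L B) {A \<in> apartments P L n. \<alpha> \<subseteq> A}"
    if "(\<alpha>, B) \<in> roots_with_interior P L n" for \<alpha> B
    using that unfolding roots_with_interior_def
  proof (elim UnE CollectE exE conjE Pair_inject)
    fix p i
    assume h: "\<alpha> = root1 P L n p i" "B = root1_interior P L n p i" "polar_frame P L n p" "i \<in> frame_index n"
    show ?thesis
      unfolding acts_transitively_def
    proof (intro conjI ballI)
      fix g A assume g: "g \<in> root_elations P L B" and A: "A \<in> {A \<in> apartments P L n. \<alpha> \<subseteq> A}"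
      have cg: "collineation P L g" using g unfolding root_elations_def by blast
      have "g ` S = S" if "S \<in> \<alpha>" for S
        using root1_stable[OF h(3,4)] g that unfolding h(1,2) .
      from root_elations_apartment[OF cg this]
      show "image g ` A \<in> {A \<in> apartments P L n. \<alpha> \<subseteq> A}" using A by blast
    next
      fix A A' assume "A \<in> {A \<in> apartments P L n. \<alpha> \<subseteq> A}" "A' \<in> {A \<in> apartments P L n. \<alpha> \<subseteq> A}"
      then show "\<exists>g\<in>root_elations P L B. image g ` A = A'"
        using root1_transitive[OF assms(1) n h(3,4)] h by blast
    qed
  next
    fix p i j
    assume h: "\<alpha> = root2 P L n p i j" "B = root2_interior P L n p i j" "polar_frame P L n p"
      "i \<in> frame_index n" "j \<in> frame_index n" "p i \<noteq> p j" "p i \<perp> p j"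
    note ij = frame_col_distinct[OF h(3-7)]
    show ?thesis
      unfolding acts_transitively_def
    proof (intro conjI ballI)
      fix g A assume g: "g \<in> root_elations P L B" and A: "A \<in> {A \<in> apartments P L n. \<alpha> \<subseteq> A}"
      have cg: "collineation P L g" using g unfolding root_elations_def by blast
      have "g ` S = S" if "S \<in> \<alpha>" for S
        using root2_stable[OF h(3-5) ij] g that unfolding h(1,2) .
      from root_elations_apartment[OF cg this]
      show "image g ` A \<in> {A \<in> apartments P L n. \<alpha> \<subseteq> A}" using A by blast
    next
      fix A A' assume "A \<in> {A \<in> apartments P L n. \<alpha> \<subseteq> A}" "A' \<in> {A \<in> apartments P L n. \<alpha> \<subseteq> A}"
      then show "\<exists>g\<in>root_elations P L B. image g ` A = A'"
        using root2_transitive[OF assms(2) h(3-5) ij] h by blast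
    qed
  qed
  then show ?thesis unfolding moufang_def by blast
qed

subsection \<open>Elations in Moufang polar spaces\<close>

lemma gen_exchange:
  assumes l: "l \<in> L" "a \<in> l" "b \<in> l" "s \<in> l" "a \<noteq> b" "s \<noteq> b"
    and X: "X \<subseteq> P" "a \<in> X" "b \<in> X"
  shows "gen (insert s (X - {a})) = gen X"
proof -
  have half: "gen (insert t Z) \<subseteq> gen Y"
    if "b \<in> Y" "u \<in> Y" "u \<in> l" "u \<noteq> b" "t \<in> l" "Y \<subseteq> P" "Z \<subseteq> Y" for Y Z u t
  proof -
    have Y: "Y \<subseteq> gen Y" by (rule gen_incl)
    have "l \<subseteq> gen Y"
      using subspaceD[OF gen_subspace[OF that(6)] l(1) that(3) l(3) _ _ that(4)] Y that by blast
    then have "insert t Z \<subseteq> gen Y" using Y that(5,7) by blast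
    then show ?thesis by (rule gen_least[OF gen_subspace[OF that(6)]])
  qed
  have sP: "s \<in> P" using l line_sub by blast
  show ?thesis
  proof
    show "gen (insert s (X - {a})) \<subseteq> gen X"
      by (rule half[of X a]) (use l X in auto)
    have "gen (insert a (X - {a})) \<subseteq> gen (insert s (X - {a}))"
      by (rule half[of _ s]) (use l X sP in auto)
    then show "gen X \<subseteq> gen (insert s (X - {a}))" using X(2) by (simp add: insert_absorb)
  qed
qed

lemma acts_transitivelyD:
  "acts_transitively act G X \<Longrightarrow> x \<in> X \<Longrightarrow> y \<in> X \<Longrightarrow> \<exists>g\<in>G. act g x = y"
  unfolding acts_transitively_def by blast

text \<open>Members of the root change generators but not their span: one with generator
  \<open>p i\<close> also has \<open>p (- j)\<close> (\<open>root2_memD\<close>), so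
  \<open>p i\<close> can be exchanged for \<open>s\<close> on the line joining them, and likewise
  \<open>p j\<close> for \<open>r\<close>.\<close>

lemma root2_frame_update:
  assumes fr: "polar_frame P L n p" and i: "i \<in> frame_index n" and j: "j \<in> frame_index n"
    and ij: "i \<noteq> j" "i + j \<noteq> 0"
    and l: "l \<in> L" "p i \<in> l" "p (- j) \<in> l" and k: "k \<in> L" "p j \<in> k" "p (- i) \<in> k"
    and s: "s \<in> l" "\<not> s \<perp> p (- i)" and r: "r \<in> k" "\<not> r \<perp> p (- j)" and rs: "r \<perp> s"
  shows "polar_frame P L n (p(i := s, j := r))" (is "polar_frame P L n ?q")
    and "root2 P L n p i j \<subseteq> frame_apartment P L n (p(i := s, j := r))"
proof -
  let ?I = "frame_index n"
  have m: "- i \<in> ?I" "- j \<in> ?I" "i \<noteq> - i" "j \<noteq> - j" "i \<noteq> - j" "j \<noteq> - i"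
    using i j ij by (auto simp: frame_index_def)
  have sP: "s \<in> P" and rP: "r \<in> P" using s r l k line_sub by blast+
  have ne: "p i \<noteq> p (- j)" "p j \<noteq> p (- i)"
    using fr i j m unfolding polar_frame_def inj_on_def by blast+
  have cs: "s \<perp> p a" if "a \<in> ?I" "a \<noteq> - i" "a \<noteq> j" for a
  proof -
    have "a + i \<noteq> 0" "a + - j \<noteq> 0" using that by auto
    then have "p a \<perp> p i" "p a \<perp> p (- j)" using frame_col[OF fr that(1)] i m by blast+
    then show ?thesis using col_line_all[OF l ne(1) _ _ s(1)] col_sym by blast
  qed
  have cr: "r \<perp> p a" if "a \<in> ?I" "a \<noteq> - j" "a \<noteq> i" for a
  proof -
    have "a + j \<noteq> 0" "a + - i \<noteq> 0" using that by auto
    then have "p a \<perp> p j" "p a \<perp> p (- i)" using frame_col[OF fr that(1)] j m by blast+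
    then show ?thesis using col_line_all[OF k ne(2) _ _ r(1)] col_sym by blast
  qed
  have cs': "p a \<perp> s" if "a \<in> ?I" "a \<noteq> - i" "a \<noteq> j" for a using cs that col_sym by blast
  have cr': "p a \<perp> r" if "a \<in> ?I" "a \<noteq> - j" "a \<noteq> i" for a using cr that col_sym by blast
  have op: "\<not> p (- i) \<perp> s" "\<not> p (- j) \<perp> r" "s \<perp> r" using s r rs col_sym by blast+
  show q: "polar_frame P L n ?q"
  proof (rule frameI)
    fix a assume a: "a \<in> ?I"
    then show "?q a \<in> P" using sP rP frame_in[OF fr] by simp
    show "\<not> ?q a \<perp> ?q (- a)"
    proof (cases "a \<in> {i, j, - i, - j}")
      case True
      then show ?thesis using m ij s r op by auto
    next
      case False
      then have "- a \<noteq> i" "- a \<noteq> j" by auto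
      then show ?thesis using False frame_uminus[OF a fr] by simp
    qed
  next
    fix a b assume ab: "a \<in> ?I" "b \<in> ?I" "a \<noteq> b" "a + b \<noteq> 0"
    have "a \<noteq> - b" "b \<noteq> - a" using ab by auto
    then show "?q a \<perp> ?q b"
      using ab cs cs' cr cr' rs op(3) frame_col[OF fr ab(1,2)] ij(1) by auto
  qed
  show "root2 P L n p i j \<subseteq> frame_apartment P L n ?q"
  proof
    fix S assume S: "S \<in> root2 P L n p i j"
    then have Sa: "S \<in> frame_apartment P L n p" unfolding root2_def by blast
    then obtain X where X: "X \<subseteq> p ` ?I" "S = gen X" "\<And>x y. x \<in> X \<Longrightarrow> y \<in> X \<Longrightarrow> x \<perp> y"
      using apartment_genD[OF fr] by metis
    have XP: "X \<subseteq> P" using X(1) frame_sub[OF fr] by blast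
    have Xq: "x \<in> ?q ` ?I" if x: "x \<in> X" "x \<noteq> p i" "x \<noteq> p j" for x
    proof -
      obtain a where a: "a \<in> ?I" "x = p a" using x X by blast
      then have "a \<noteq> i" "a \<noteq> j" using x by blast+
      then have "?q a = x" using a by simp
      then show ?thesis using a by blast
    qed
    have "?q i \<in> ?q ` ?I" "?q j \<in> ?q ` ?I" using i j by blast+
    then have sr: "s \<in> ?q ` ?I" "r \<in> ?q ` ?I" using ij by simp_all
    have "\<exists>Y\<subseteq>?q ` ?I. S = gen Y"
    proof -
      consider "p i \<in> X" | "p j \<in> X" | "p i \<notin> X" "p j \<notin> X" by blast
      then show ?thesis
      proof cases
        case 1
        have mj: "p (- j) \<in> X" using root2_memD[OF fr i j _ 1 X(1,3)] S X(2) by blast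
        then have "p j \<notin> X" using X(3) frame_uminus[OF j fr] by blast
        then have "insert s (X - {p i}) \<subseteq> ?q ` ?I" using Xq sr by blast
        moreover have "s \<noteq> p (- j)" using s frame_col[OF fr m(2,1)] ij by auto
        ultimately show ?thesis using gen_exchange[OF l s(1) ne(1) _ XP 1 mj] X(2) by metis
      next
        case 2
        have mi: "p (- i) \<in> X"
          using root2_memD[OF fr j i _ 2 X(1,3)] S X(2) root2_sym[of _ _ i j] by metis
        then have "p i \<notin> X" using X(3) frame_uminus[OF i fr] by blast
        then have "insert r (X - {p j}) \<subseteq> ?q ` ?I" using Xq sr by blast
        moreover have "r \<noteq> p (- i)" using r frame_col[OF fr m(1,2)] ij by auto
        ultimately show ?thesis using gen_exchange[OF k r(1) ne(2) _ XP 2 mi] X(2) by metis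
      next
        case 3
        then have "X \<subseteq> ?q ` ?I" using Xq by blast
        then show ?thesis using X(2) by blast
      qed
    qed
    moreover have "singular S" using Sa unfolding frame_apartment_def by blast
    ultimately show "S \<in> frame_apartment P L n ?q" unfolding frame_apartment_def by blast
  qed
qed

lemma moufang_root2_move:
  assumes mf: "moufang P L n"
    and fr: "polar_frame P L n p" and i: "i \<in> frame_index n" and j: "j \<in> frame_index n"
    and ij: "i \<noteq> j" "i + j \<noteq> 0"
    and l: "l \<in> L" "p i \<in> l" "p (- j) \<in> l" and s: "s \<in> l" "s \<noteq> p (- j)"
  shows "\<exists>g\<in>root_elations P L (root2_interior P L n p i j). g (p i) = s"
proof -
  let ?I = "frame_index n"
  have m: "- i \<in> ?I" "- j \<in> ?I" "- j \<noteq> i" "- j \<noteq> j"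
    using i j ij by (auto simp: frame_index_def)
  have inj: "p a \<noteq> p b" if "a \<in> ?I" "b \<in> ?I" "a \<noteq> b" for a b
    using fr that unfolding polar_frame_def inj_on_def by blast
  have col: "p j \<perp> p (- i)" "p (- i) \<perp> p (- j)" "p i \<perp> p j"
    using frame_col[OF fr] i j m ij by auto
  have "j \<noteq> - i" using ij by auto
  then obtain k where k: "k \<in> L" "p j \<in> k" "p (- i) \<in> k"
    using col(1) inj[OF j m(1)] col_obtain_line by metis
  have "\<not> p (- i) \<perp> s"
    using col_line_all[OF l(1) s(1) l(3) s(2) _ col(2) l(2)] frame_uminus[OF i fr] col_sym by blast
  then have si: "\<not> s \<perp> p (- i)" using col_sym by blast
  have sP: "s \<in> P" using l s line_sub by blast
  \<comment> \<open>Once \<open>s\<close> replaces \<open>p i\<close>, the point replacing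
    \<open>p j\<close> on \<open>k\<close> must be the one collinear with \<open>s\<close>.\<close>
  obtain r where r: "r \<in> k" "s \<perp> r" using col_line_ex[OF k(1) sP] .
  have rn: "r \<noteq> p (- i)" using r si by blast
  have rj: "\<not> r \<perp> p (- j)"
    using col_line_all[OF k(1) r(1) k(3) rn _ _ k(2)] col(2) frame_uminus[OF j fr] col_sym by metis
  have rs: "r \<perp> s" using r col_sym by blast
  let ?q = "p(i := s, j := r)"
  note q = root2_frame_update[OF fr i j ij l k s(1) si r(1) rj rs]
  let ?\<alpha> = "root2 P L n p i j" and ?B = "root2_interior P L n p i j"
  have "(?\<alpha>, ?B) \<in> roots_with_interior P L n"
    using fr i j inj[OF i j ij(1)] col(3) unfolding roots_with_interior_def by blast
  then have act: "acts_transitively (\<lambda>g A. image g ` A) (root_elations P L ?B)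
      {A \<in> apartments P L n. ?\<alpha> \<subseteq> A}"
    using mf unfolding moufang_def by blast
  have A1: "frame_apartment P L n p \<in> {A \<in> apartments P L n. ?\<alpha> \<subseteq> A}"
    using fr unfolding apartments_def root2_def by blast
  have A2: "frame_apartment P L n ?q \<in> {A \<in> apartments P L n. ?\<alpha> \<subseteq> A}"
    using q unfolding apartments_def by blast
  obtain g where g: "g \<in> root_elations P L ?B"
    "image g ` frame_apartment P L n p = frame_apartment P L n ?q"
    using acts_transitivelyD[OF act A1 A2] by (elim bexE)
  have cg: "collineation P L g" using g(1) unfolding root_elations_def by blast
  have "{p i} \<in> frame_apartment P L n p" using apartment_point_iff[OF frame_sub[OF fr]] i by blast
  then have "g ` {p i} \<in> frame_apartment P L n ?q" unfolding g(2)[symmetric] by (rule imageI)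
  then have "g (p i) \<in> ?q ` ?I" using apartment_point_iff[OF frame_sub[OF q(1)]] by simp
  then obtain a where a: "a \<in> ?I" "g (p i) = ?q a" by blast
  have gj: "g (p (- j)) = p (- j)" using root2_elation_fixes[OF fr i j ij g(1) m(2-4)] .
  have "{p (- j)} \<in> ?B"
  proof -
    have "gen {p (- j)} \<in> ?B"
      by (rule root2_interior_gen[OF fr i j ij])
        (use m i j inj[OF i m(2)] inj[OF j m(2)] col_refl frame_in[OF fr m(2)] in auto)
    then show ?thesis using gen_single[OF frame_in[OF fr m(2)]] by simp
  qed
  then have "g ` l = l" using root_elationsD(3)[OF g(1) _ line_singular[OF l(1)]] l(3) by blast
  then have gl: "g (p i) \<in> l" using l(2) by blast
  have gn: "g (p i) \<noteq> p (- j)" using collineation_inj[OF cg, of "p i" "p (- j)"] gj inj[OF i m(2)] m by auto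
  \<comment> \<open>\<open>g (p i)\<close> is a point of \<open>l\<close> other than
    \<open>p (- j)\<close> in the new frame. It is not \<open>r\<close>, which is opposite
    \<open>p (- j)\<close>. Nor is it an old point \<open>p a\<close>, since \<open>p (- a)\<close>
    would be collinear with \<open>p i\<close> and \<open>p (- j)\<close>, hence with all of
    \<open>l\<close>.\<close>
  have "a \<noteq> j"
  proof
    assume "a = j"
    then have "r \<in> l" using a gl by simp
    then show False using rj col_line[OF l(1)] l(3) by blast
  qed
  moreover have "a = i" if "a \<noteq> j"
  proof (rule ccontr)
    assume ai: "a \<noteq> i"
    then have pa: "g (p i) = p a" using a that by simp
    then have "a \<noteq> - j" using gn by blast
    then have "- a + i \<noteq> 0" "- a + - j \<noteq> 0" "- a \<in> ?I" using ai a by auto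
    then have "p (- a) \<perp> p i" "p (- a) \<perp> p (- j)" using frame_col[OF fr] i m by blast+
    then have "p (- a) \<perp> p a" using col_line_all[OF l inj[OF i m(2)]] m gl pa by metis
    then show False using frame_uminus[OF a(1) fr] col_sym by blast
  qed
  ultimately have "g (p i) = s" using a ij by simp
  then show ?thesis using g(1) by blast
qed

text \<open>All frame points other than \<open>p i\<close> are fixed, so by injectivity
  \<open>p i\<close> can only go to the one new point \<open>y\<close>.\<close>

lemma moufang_root1_move:
  assumes mf: "moufang P L n" and fr: "polar_frame P L n p" and i: "i \<in> frame_index n"
    and y: "y \<in> P" "\<not> y \<perp> p (- i)"
    and c: "\<And>k. k \<in> frame_index n \<Longrightarrow> k \<noteq> i \<Longrightarrow> k \<noteq> - i \<Longrightarrow> y \<perp> p k"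
  shows "\<exists>g\<in>root_elations P L (root1_interior P L n p i). g (p i) = y"
proof -
  let ?I = "frame_index n" and ?q = "p(i := y)"
  let ?\<alpha> = "root1 P L n p i" and ?B = "root1_interior P L n p i"
  note q = root1_frame_update[OF fr i y c]
  have "(?\<alpha>, ?B) \<in> roots_with_interior P L n"
    using fr i unfolding roots_with_interior_def by blast
  then have act: "acts_transitively (\<lambda>g A. image g ` A) (root_elations P L ?B)
      {A \<in> apartments P L n. ?\<alpha> \<subseteq> A}"
    using mf unfolding moufang_def by blast
  have A1: "frame_apartment P L n p \<in> {A \<in> apartments P L n. ?\<alpha> \<subseteq> A}"
    using fr unfolding apartments_def root1_def by blast
  have A2: "frame_apartment P L n ?q \<in> {A \<in> apartments P L n. ?\<alpha> \<subseteq> A}"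
    using q unfolding apartments_def by blast
  obtain g where g: "g \<in> root_elations P L ?B"
    "image g ` frame_apartment P L n p = frame_apartment P L n ?q"
    using acts_transitivelyD[OF act A1 A2] by (elim bexE)
  have cg: "collineation P L g" using g(1) unfolding root_elations_def by blast
  have "{p i} \<in> frame_apartment P L n p" using apartment_point_iff[OF frame_sub[OF fr]] i by blast
  then have "g ` {p i} \<in> frame_apartment P L n ?q" unfolding g(2)[symmetric] by (rule imageI)
  then have "g (p i) \<in> ?q ` ?I" using apartment_point_iff[OF frame_sub[OF q(1)]] by simp
  then obtain a where a: "a \<in> ?I" "g (p i) = ?q a" by blast
  have "a = i"
  proof (rule ccontr)
    assume ai: "a \<noteq> i"
    then have "g (p i) = g (p a)" using root1_elation_fixes[OF fr i g(1) a(1)] a(2) by simp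
    then have "p i = p a" using collineation_inj[OF cg] by blast
    then show False using ai i a(1) fr unfolding polar_frame_def inj_on_def by blast
  qed
  then show ?thesis using g(1) a(2) by auto
qed

section \<open>Properties (M1) and (M2) from the Moufang property\<close>

lemma two_pair_frame:
  assumes 1: "a \<in> P" "a' \<in> P" "\<not> a \<perp> a'" and 2: "b \<in> P" "b' \<in> P" "\<not> b \<perp> b'"
    and c: "a \<perp> b" "a \<perp> b'" "a' \<perp> b" "a' \<perp> b'"
  obtains p where "polar_frame P L 2 p" "p 1 = a" "p (- 1) = a'" "p 2 = b" "p (- 2) = b'"
proof -
  let ?p = "\<lambda>k::int. if k = 1 then a else if k = - 1 then a' else if k = 2 then b else b'"
  have I: "k \<in> frame_index 2 \<longleftrightarrow> k = 1 \<or> k = - 1 \<or> k = 2 \<or> k = - 2" for k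
    by (auto simp: frame_index_def)
  have c': "b \<perp> a" "b' \<perp> a" "b \<perp> a'" "b' \<perp> a'" "\<not> a' \<perp> a" "\<not> b' \<perp> b"
    using c 1 2 col_sym by blast+
  have "polar_frame P L 2 ?p"
    by (rule frameI; unfold I; elim disjE; simp add: 1 2 c c')
  then show ?thesis by (rule that) simp_all
qed

text \<open>With \<open>p\<close>, \<open>q\<close> as the interior points \<open>f (- 2)\<close>,
  \<open>f (- 1)\<close> and \<open>r\<close> as \<open>f 1\<close>, the line \<open>K\<close> joins
  \<open>f 1\<close> to \<open>f (- 2)\<close>, and \<open>moufang_root2_move\<close> moves
  \<open>r\<close> along it.\<close>

lemma moufang_imp_M2:
  assumes mf: "moufang P L n" and rank: "has_finite_rank P L n"
  shows "property_M2 P L"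
proof -
  have "acts_transitively (\<lambda>g y. g y) (line_elations P L p M q) (K - {p})"
    if M: "M \<in> L" "p \<in> M" "q \<in> M" "p \<noteq> q" and K: "K \<in> L" "p \<in> K" "K \<noteq> M" "\<not> coplanar_lines P L K M"
    for M p q K
    unfolding acts_transitively_def
  proof (intro conjI ballI)
    fix g x assume g: "g \<in> line_elations P L p M q" and x: "x \<in> K - {p}"
    have "g ` K = K" using line_elationsD(3)[OF g line_singular[OF K(1)] K(2)] .
    moreover have "g p = p" using line_elationsD(2)[OF g M(2)] .
    ultimately show "g x \<in> K - {p}"
      using x collineation_inj[OF line_elationsD(1)[OF g], of x p] by auto
  next
    fix r r' assume r: "r \<in> K - {p}" and r': "r' \<in> K - {p}"
    have rq: "\<not> r \<perp> q"
      using coplanar_lines_iff[OF K(1) M(1) K(3,2) M(2), of r q] K(4) r M by blast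
    have pq: "p \<perp> q" "p \<perp> r" using col_line M K r by blast+
    \<comment> \<open>\<open>r\<close> and \<open>q\<close> are already opposite; \<open>p\<close>
      still needs an opposite partner within their common perp.\<close>
    then obtain s where s: "s \<perp> q" "s \<perp> r" "\<not> s \<perp> p"
      using opposite_perp_nondegenerate[of q r p] rq col_sym by blast
    obtain f0 where f0: "polar_frame P L 2 f0" "f0 1 = r" "f0 (- 1) = q" "f0 2 = s" "f0 (- 2) = p"
      by (rule two_pair_frame[of r q s p]) (use rq s pq col_in col_sym in blast)+
    obtain f where f: "polar_frame P L n f" "\<forall>k\<in>frame_index 2. f k = f0 k"
      using frame_extend[OF rank f0(1)] by blast
    have fv: "f 1 = r" "f (- 1) = q" "f 2 = s" "f (- 2) = p"
      using f(2) f0 by (auto simp: frame_index_def)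
    have "2 \<le> n" using frame_le_rank[OF rank f0(1)] .
    then have I: "1 \<in> frame_index n" "2 \<in> frame_index n" "(1::int) \<noteq> 2" "(1::int) + 2 \<noteq> 0"
      "- 2 \<in> frame_index n" "- 2 \<noteq> (1::int)" "- 2 \<noteq> (2::int)"
      "- 1 \<in> frame_index n" "- 1 \<noteq> (2::int)" "- 1 \<noteq> (1::int)"
      by (auto simp: frame_index_def)
    let ?B = "root2_interior P L n f 1 2"
    obtain g where g: "g \<in> root_elations P L ?B" "g r = r'"
      using moufang_root2_move[OF mf f(1) I(1-4), of K r'] K r r' fv by auto
    have "gen {q, p} = M" using gen_pair M by blast
    then have MB: "M \<in> ?B" using root2_interior_pair[OF f(1) I(1-7)] fv by simp
    \<comment> \<open>At index \<open>- 1\<close> the pair in \<open>root2_interior_pair\<close> is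
      \<open>q\<close> repeated, so its span is a point of the interior.\<close>
    have qB: "{q} \<in> ?B"
      using root2_interior_pair[OF f(1) I(1-4,8,10,9)] fv gen_single[of q] pq col_in by simp
    have pB: "{p} \<in> ?B"
      using root2_interior_pair[OF f(1) I(2,1), of "- 2"] root2_interior_sym[of _ _ 1 2]
        fv gen_single[of p] pq col_in I by simp
    have "g \<in> line_elations P L p M q"
      unfolding line_elations_def fixes_pointwise_def stabilizes_def
      using root_elationsD(1,2)[OF g(1) MB] root_elationsD(3)[OF g(1) pB] root_elationsD(3)[OF g(1) qB]
      by blast
    then show "\<exists>g\<in>line_elations P L p M q. g r = r'" using g(2) by blast
  qed
  then show ?thesis unfolding property_M2_def by blast
qed

lemma point_elation_comp:
  assumes g: "g \<in> point_elations P L K c K'" and h: "h \<in> point_elations P L K c K'"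
  shows "g \<circ> h \<in> point_elations P L K c K'"
proof -
  have "stabilizes (g \<circ> h) S" if "singular S" "c \<in> S" for S
    using point_elationsD(4)[OF g that] point_elationsD(4)[OF h that] unfolding stabilizes_def
    by (metis image_comp)
  moreover have "fixes_pointwise (g \<circ> h) K" "fixes_pointwise (g \<circ> h) K'"
    using point_elationsD(2,3)[OF g] point_elationsD(2,3)[OF h] unfolding fixes_pointwise_def by simp_all
  ultimately show ?thesis
    using collineation_comp[OF point_elationsD(1)[OF g] point_elationsD(1)[OF h]]
    unfolding point_elations_def by blast
qed

text \<open>
  Roots of the second kind move \<open>y\<close> along lines.  If \<open>y\<close> and \<open>y'\<close> are not connected by two such
  moves, then \<open>{c, y, x, x'}\<^sup>\<bottom> \<subseteq> y'\<^sup>\<bottom>\<close>, and any frame through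
  \<open>c, y, x, x'\<close> yields a root of the first kind moving \<open>y\<close> to \<open>y'\<close>.
\<close>

lemma moufang_imp_M1:
  assumes mf: "moufang P L n" and rank: "has_finite_rank P L n"
  shows "property_M1 P L"
proof -
  have "acts_transitively (\<lambda>g y. g y) (point_elations P L K c K')
      {y \<in> perp P L x \<inter> perp P L x'. opposite_pts P L c y}"
    if c: "c \<in> P" and K: "K \<in> L" "c \<in> K" "x \<in> K" "x \<noteq> c" and K': "K' \<in> L" "c \<in> K'" "x' \<in> K'" "x' \<noteq> c"
      and KK: "K \<noteq> K'" "\<not> coplanar_lines P L K K'"
    for c K K' x x'
  proof -
    let ?E = "point_elations P L K c K'"
    have xx: "\<not> x \<perp> x'" using coplanar_lines_iff[of K K' c x x'] K K' KK by blast
    have cx: "c \<perp> x" "c \<perp> x'" using col_line K K' by blast+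
    have xP: "x \<in> P" "x' \<in> P" using cx col_in by blast+
    define Y where "Y = {y. y \<in> P \<and> y \<perp> x \<and> y \<perp> x' \<and> \<not> y \<perp> c}"
    have Yeq: "{y \<in> perp P L x \<inter> perp P L x'. opposite_pts P L c y} = Y"
      unfolding Y_def perp_def opposite_pts_def using c col_sym by blast
    have fr2: "\<exists>f. polar_frame P L 2 f \<and> f 1 = c \<and> f (- 1) = y \<and> f 2 = x \<and> f (- 2) = x'" if "y \<in> Y" for y
    proof -
      have "\<not> c \<perp> y" "y \<in> P" "y \<perp> x" "y \<perp> x'" using that col_sym unfolding Y_def by blast+
      then show ?thesis using two_pair_frame[of c y x x'] c xP xx cx by metis
    qed
    \<comment> \<open>The test for both kinds of roots: \<open>{c}\<close> in the interior makes
      \<open>g\<close> stabilize every singular subspace through \<open>c\<close>, and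
      \<open>K\<close>, \<open>K'\<close> in the interior are fixed pointwise.\<close>
    have inE: "g \<in> ?E"
      if "g \<in> root_elations P L B" "{c} \<in> B" "K \<in> B" "K' \<in> B" for g B
      unfolding point_elations_def fixes_pointwise_def stabilizes_def
      using root_elationsD[OF that(1,2)] root_elationsD(2)[OF that(1,3)] root_elationsD(2)[OF that(1,4)]
      by blast
    have gens: "gen {c, c} = {c}" "gen {c, x} = K" "gen {c, x'} = K'"
      using gen_single[OF c] gen_pair K K' by auto
    have move1: "\<exists>g\<in>?E. g y = y'"
      if y: "y \<in> Y" and y': "y' \<in> Y"
        and sub: "\<And>u. u \<perp> c \<Longrightarrow> u \<perp> y \<Longrightarrow> u \<perp> x \<Longrightarrow> u \<perp> x' \<Longrightarrow> u \<perp> y'" for y y'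
    proof -
      obtain f0 where f0: "polar_frame P L 2 f0" "f0 1 = c" "f0 (- 1) = y" "f0 2 = x" "f0 (- 2) = x'"
        using fr2[OF y] by blast
      obtain f where f: "polar_frame P L n f" "\<forall>k\<in>frame_index 2. f k = f0 k"
        using frame_extend[OF rank f0(1)] by blast
      have fv: "f 1 = c" "f (- 1) = y" "f 2 = x" "f (- 2) = x'"
        using f(2) f0 by (auto simp: frame_index_def)
      have "2 \<le> n" using frame_le_rank[OF rank f0(1)] .
      then have I: "1 \<in> frame_index n" "- 1 \<in> frame_index n" "2 \<in> frame_index n" "- 2 \<in> frame_index n"
        by (auto simp: frame_index_def)
      \<comment> \<open>The point to be replaced is \<open>y = f (- 1)\<close>; \<open>sub\<close>
        covers the frame points beyond the two given pairs.\<close>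
      have "y' \<perp> f k" if k: "k \<in> frame_index n" "k \<noteq> - 1" "k \<noteq> - (- 1)" for k
      proof -
        consider "k = 2" | "k = - 2" | "k + 1 \<noteq> 0" "k + - 1 \<noteq> 0" "k + 2 \<noteq> 0" "k + - 2 \<noteq> 0"
          using k by fastforce
        then show ?thesis
        proof cases
          case 3
          then have "f k \<perp> c" "f k \<perp> y" "f k \<perp> x" "f k \<perp> x'"
            using frame_col[OF f(1) k(1)] I fv by metis+
          then show ?thesis using sub col_sym by blast
        qed (use fv y' Y_def in auto)
      qed
      moreover have "y' \<in> P" "\<not> y' \<perp> f (- (- 1))" using y' fv unfolding Y_def by simp_all
      ultimately obtain g where g: "g \<in> root_elations P L (root1_interior P L n f (- 1))" "g (f (- 1)) = y'"
        using moufang_root1_move[OF mf f(1) I(2), of y'] by blast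
      have "gen {c, f k} \<in> root1_interior P L n f (- 1)" if "k \<in> frame_index n" "k \<noteq> - 1" for k
        using root1_interior_mem[OF f(1) I(2) that] fv by simp
      from this[OF I(1)] this[OF I(3)] this[OF I(4)]
      have "g \<in> ?E" using fv gens by (intro inE[OF g(1)]) simp_all
      then show ?thesis using g(2) fv by auto
    qed
    have move2: "\<exists>g\<in>?E. g y = y'" if y: "y \<in> Y" and y': "y' \<in> Y" and yy: "y \<perp> y'" for y y'
    proof (cases "y = y'")
      case True
      then show ?thesis using move1 y by blast
    next
      case False
      then obtain l where l: "l \<in> L" "y \<in> l" "y' \<in> l" using yy col_obtain_line by blast
      \<comment> \<open>\<open>q\<close> becomes the second interior point \<open>f 3\<close> beside
        \<open>c = f 1\<close>, and an opposite \<open>r = f (- 3)\<close> is removed along with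
        \<open>y = f (- 1)\<close>. Then \<open>l\<close> joins the removed point \<open>y\<close>
        to \<open>q\<close>, which is the line along which the root elations move
        \<open>y\<close>.\<close>
      obtain q where q: "q \<in> l" "c \<perp> q" using col_line_ex[OF l(1) c] .
      have qn: "q \<noteq> y" "q \<noteq> y'" using q y y' col_sym unfolding Y_def by blast+
      have "x \<perp> q" "x' \<perp> q"
        using col_line_all[OF l False _ _ q(1)] y y' col_sym unfolding Y_def by blast+
      then have qx: "q \<perp> x" "q \<perp> x'" "q \<perp> c" "q \<perp> y" using q l col_line col_sym by blast+
      obtain f0 where f0: "polar_frame P L 2 f0" "f0 1 = c" "f0 (- 1) = y" "f0 2 = x" "f0 (- 2) = x'"
        using fr2[OF y] by blast
      have I2: "frame_index 2 = {1, - 1, 2, - 2}" by (auto simp: frame_index_def)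
      have qf: "\<forall>k\<in>frame_index 2. q \<perp> f0 k" unfolding I2 using qx f0 by simp
      have qP: "q \<in> P" using qx col_in by blast
      obtain r where r: "r \<in> P" "\<forall>k\<in>frame_index 2. r \<perp> f0 k" "\<not> r \<perp> q"
        using frame_nondegenerate[OF polar f0(1) qP qf] by blast
      let ?f1 = "f0(int (Suc 2) := q, - int (Suc 2) := r)"
      have f1: "polar_frame P L (Suc 2) ?f1"
        using frame_add_pair[OF f0(1) qf r(2) qP r(1)] r(3) col_sym by blast
      obtain f where f: "polar_frame P L n f" "\<forall>k\<in>frame_index (Suc 2). f k = ?f1 k"
        using frame_extend[OF rank f1] by blast
      have fv: "f 1 = c" "f (- 1) = y" "f 2 = x" "f (- 2) = x'" "f 3 = q" "f (- 3) = r"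
        using f(2) f0 by (auto simp: frame_index_def)
      \<comment> \<open>Two distinct collinear points of \<open>Y\<close> force rank at least 3; in
        rank 2 this case does not occur.\<close>
      have "Suc 2 \<le> n" using frame_le_rank[OF rank f1] .
      then have I: "- 1 \<in> frame_index n" "- 3 \<in> frame_index n" "- 1 \<noteq> (- 3::int)" "- 1 + - 3 \<noteq> (0::int)"
        and I': "1 \<in> frame_index n" "2 \<in> frame_index n" "- 2 \<in> frame_index n"
        by (auto simp: frame_index_def)
      obtain g where g: "g \<in> root_elations P L (root2_interior P L n f (- 1) (- 3))" "g (f (- 1)) = y'"
        using moufang_root2_move[OF mf f(1) I, of l y'] l q(1) qn fv by auto
      have "gen {c, f k} \<in> root2_interior P L n f (- 1) (- 3)"
        if "k \<in> frame_index n" "k \<noteq> - 1" "k \<noteq> - 3" for k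
        using root2_interior_pair[OF f(1) I that] fv by simp
      from this[OF I'(1)] this[OF I'(2)] this[OF I'(3)]
      have "g \<in> ?E" using fv gens by (intro inE[OF g(1)]) simp_all
      then show ?thesis using g(2) fv by auto
    qed
    have trans: "\<exists>g\<in>?E. g y = y'" if y: "y \<in> Y" and y': "y' \<in> Y" for y y'
    proof (cases "\<exists>q. q \<perp> c \<and> q \<perp> y \<and> q \<perp> x \<and> q \<perp> x' \<and> \<not> q \<perp> y'")
      case False
      then show ?thesis using move1[OF y y'] by blast
    next
      case True
      then obtain q where q: "q \<perp> c" "q \<perp> y" "q \<perp> x" "q \<perp> x'" "\<not> q \<perp> y'" by blast
      have qy: "q \<noteq> y" using q y unfolding Y_def by blast
      then obtain l where l: "l \<in> L" "q \<in> l" "y \<in> l" using q col_obtain_line by blast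
      have "y' \<in> P" using y' unfolding Y_def by blast
      \<comment> \<open>\<open>t\<close> is the stop between \<open>y\<close> and \<open>y'\<close>.
        It differs from \<open>q\<close> because \<open>q\<close> is opposite \<open>y'\<close>, so
        it is opposite \<open>c\<close>; and it is collinear with \<open>x\<close> and
        \<open>x'\<close> because \<open>q\<close> and \<open>y\<close> are.\<close>
      then obtain t where t: "t \<in> l" "y' \<perp> t" using col_line_ex[OF l(1)] by metis
      have tq: "t \<noteq> q" using t q col_sym by blast
      have "x \<perp> t" "x' \<perp> t"
        using col_line_all[OF l qy _ _ t(1)] q y col_sym unfolding Y_def by blast+
      moreover have "\<not> c \<perp> t"
        using col_line_all[OF l(1) t(1) l(2) tq _ _ l(3)] q(1) y col_sym unfolding Y_def by blast
      ultimately have tY: "t \<in> Y" using col_sym col_in unfolding Y_def by blast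
      obtain h where h: "h \<in> ?E" "h y = t" using move2[OF y tY] col_line[OF l(1,3) t(1)] by blast
      obtain g where g: "g \<in> ?E" "g t = y'" using move2[OF tY y'] t(2) col_sym by blast
      show ?thesis using point_elation_comp[OF g(1) h(1)] g(2) h(2) by (metis comp_apply)
    qed
    have "g y \<in> Y" if g: "g \<in> ?E" and y: "y \<in> Y" for g y
    proof -
      have cg: "collineation P L g" using point_elationsD(1)[OF g] .
      have fx: "g x = x" "g x' = x'" "g c = c" using point_elationsD(2,3)[OF g] K K' by blast+
      show ?thesis
        using y collineation_col[OF cg, of y x] collineation_col[OF cg, of y x']
          collineation_col[OF cg, of y c] collineation_in[OF cg, of y] fx
        unfolding Y_def by simp
    qed
    then show ?thesis using trans unfolding Yeq acts_transitively_def by blast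
  qed
  then show ?thesis unfolding property_M1_def by blast
qed

end

theorem proposition3p8:
  fixes P :: "'a set" and L :: "'a set set" and n :: nat
  assumes "polar_space P L"
    and "has_finite_rank P L n"
    and "n \<ge> 2"
    and "thick P L"
  shows "moufang P L n \<longleftrightarrow> property_M1 P L \<and> property_M2 P L"
proof -
  interpret polar P L using assms(1) by unfold_locales
  show ?thesis
    using M1_M2_imp_moufang moufang_imp_M1 moufang_imp_M2 assms(2,3) by blast
qed

end
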